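(* $$\dim H^1(P,V)=\begin{cases}0 & \text{if } l_1\neq l_2 \text{ or } N(\epsilon )^{l_1}=-1,\\ 1 & \text{if } l_1=l_2 \text{ and } N(\epsilon )^{l_1}=1.\end{cases}$$ Here $N(\epsilon )$ denotes the norm of $\epsilon$.
   Context: Let $F$ be a real quadratic field with ring of integers $\mathcal O_F=\mathbf Z+\mathbf Z\omega$, let $\epsilon$ be the fundamental unit of $F$, and for $x\in F$ let $x'$ denote its Galois conjugate. Let $\Gamma={\rm PSL}(2,\mathcal O_F)$ and $P=\{\begin{pmatrix} t & 0\\ u & t^{-1}\end{pmatrix} : t\in\mathcal O_F^{\times}, u\in\mathcal O_F\}/\{\pm 1_2\}$. Let $l_1\ge l_2\ge 0$ be integers with $l_1\equiv l_2 \bmod 2$. For $l\ge0$ let $\rho_l$ be the symmetric tensor representation of ${\rm GL}(2,\mathbf C)$ of degree $l$ on $\mathbf C^{l+1}$. Let $V=V_1\otimes V_2$ with $V_i=\mathbf C^{l_i+1}$, on which $\gamma\in\Gamma$ acts by $\rho_{l_1}(\gamma)\otimes\rho_{l_2}(\gamma')$, $\gamma'$ being the Galois conjugate matrix. *)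

theory Defs
  imports
    "Jordan_Normal_Form.VS_Connect"
    "HOL-Algebra.AbelCoset"
    "HOL-Computational_Algebra.Squarefree"
    "HOL-Number_Theory.Cong"
begin

hide_const (open) Multiset.mult Polynomial.smult

text \<open>
  The real quadratic field $F = \mathbf{Q}(\sqrt d)$, for squarefree $d > 1$, is taken with its
  embedding into the reals.
\<close>

definition quad_field :: "nat \<Rightarrow> real set" where
  "quad_field d = {of_rat a + of_rat b * sqrt (real d) | a b. True}"

text \<open>Galois conjugation; it is only meaningful on \<^term>\<open>quad_field d\<close>.\<close>

definition quad_conj :: "nat \<Rightarrow> real \<Rightarrow> real" where
  "quad_conj d x = (THE y. \<exists>a b. x = of_rat a + of_rat b * sqrt (real d) \<and>
                                 y = of_rat a - of_rat b * sqrt (real d))"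

definition quad_norm :: "nat \<Rightarrow> real \<Rightarrow> real" where
  "quad_norm d x = x * quad_conj d x"

definition quad_ints :: "nat \<Rightarrow> real set" where
  "quad_ints d = {x \<in> quad_field d. algebraic_int x}"

definition quad_units :: "nat \<Rightarrow> real set" where
  "quad_units d = {x \<in> quad_ints d. \<exists>y \<in> quad_ints d. x * y = 1}"

definition is_fundamental_unit :: "nat \<Rightarrow> real \<Rightarrow> bool" where
  "is_fundamental_unit d e \<longleftrightarrow> e \<in> quad_units d \<and> 1 < e \<and>
     (\<forall>u \<in> quad_units d. \<exists>n::int. u = e powi n \<or> u = - (e powi n))"

definition SL2 :: "nat \<Rightarrow> real mat monoid" where
  "SL2 d = \<lparr>carrier = {A \<in> carrier_mat 2 2. elements_mat A \<subseteq> quad_ints d \<and> det A = 1},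
            mult = (*), one = 1\<^sub>m 2\<rparr>"

definition PSL2 :: "nat \<Rightarrow> real mat set monoid" where
  "PSL2 d = SL2 d Mod {1\<^sub>m 2, - 1\<^sub>m 2}"

definition lower_mat :: "real \<Rightarrow> real \<Rightarrow> real mat" where
  "lower_mat t u = mat_of_rows_list 2 [[t, 0], [u, inverse t]]"

definition parabolic :: "nat \<Rightarrow> real mat set monoid" where
  "parabolic d = (PSL2 d)\<lparr>carrier :=
     {{1\<^sub>m 2, - 1\<^sub>m 2} #>\<^bsub>SL2 d\<^esub> lower_mat t u | t u. t \<in> quad_units d \<and> u \<in> quad_ints d}\<rparr>"

text \<open>
  With $[x, y]^l = (x^l, x^{l-1}y, \ldots, y^l)$, the matrix $\rho_l(g)$ is characterised by
  $\rho_l(g)\,[w]^l = [g w]^l$: for $g$ with rows $(a, b)$ and $(c, d)$, its $(i,j)$ entry is the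
  coefficient of $x^{l-j}y^j$ in $(ax+by)^{l-i}(cx+dy)^i$ (below, $x = 1$). Equivalently, it is the
  matrix of $g^{\otimes l}$ on symmetric tensors, in the basis whose $j$-th element is the sum of
  the pure tensors with $l-j$ factors $e_1$ and $j$ factors $e_2$.
\<close>

definition sym_rep :: "nat \<Rightarrow> complex mat \<Rightarrow> complex mat" where
  "sym_rep l g = mat (l + 1) (l + 1) (\<lambda>(i, j).
     coeff ([:g $$ (0, 0), g $$ (0, 1):] ^ (l - i) * [:g $$ (1, 0), g $$ (1, 1):] ^ i) j)"

text \<open>
  $\mathbf{C}^m \otimes \mathbf{C}^n$ is realised as the space of $m \times n$ matrices, with
  $v \otimes w$ corresponding to $v w^T$; then $A \otimes B$ acts by $X \mapsto A X B^T$, that is,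
  $((A \otimes B) X)_{ij} = \sum_{k,m} A_{ik} B_{jm} X_{km}$.
\<close>

definition tensor_space :: "nat \<Rightarrow> nat \<Rightarrow> (complex, complex mat) module" where
  "tensor_space m n = module_mat TYPE(complex) m n"

definition tensor_op :: "complex mat \<Rightarrow> complex mat \<Rightarrow> complex mat \<Rightarrow> complex mat" where
  "tensor_op A B X = A * X * transpose_mat B"

text \<open>
  An element of $\mathrm{PSL}(2, \mathcal{O}_F)$ is a pair of matrices $\{g, -g\}$, which act
  identically when $l_1 \equiv l_2 \bmod 2$; \<^const>\<open>the_elem\<close> extracts the common value.
\<close>

definition V_act :: "nat \<Rightarrow> nat \<Rightarrow> nat \<Rightarrow> real mat set \<Rightarrow> complex mat \<Rightarrow> complex mat" where
  "V_act d l1 l2 S v = the_elem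
     ((\<lambda>g. tensor_op (sym_rep l1 (map_mat complex_of_real g))
                     (sym_rep l2 (map_mat complex_of_real (map_mat (quad_conj d) g))) v) ` S)"

text \<open>
  First cohomology of a group \<open>G\<close> with coefficients in a module \<open>V\<close> on which \<open>G\<close> acts linearly
  from the left by \<open>act\<close>. The ring components \<^const>\<open>monoid.mult\<close> and \<^const>\<open>monoid.one\<close> of a
  module record play no role.
\<close>

definition cochains1 ::
    "('g, 'm) monoid_scheme \<Rightarrow> ('k, 'v) module \<Rightarrow> ('k, 'g \<Rightarrow> 'v) module" where
  "cochains1 G V = \<lparr>carrier = carrier G \<rightarrow>\<^sub>E carrier V,
     mult = undefined, one = undefined,
     zero = (\<lambda>g\<in>carrier G. \<zero>\<^bsub>V\<^esub>),
     add = (\<lambda>f h. \<lambda>g\<in>carrier G. f g \<oplus>\<^bsub>V\<^esub> h g),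
     smult = (\<lambda>c f. \<lambda>g\<in>carrier G. c \<odot>\<^bsub>V\<^esub> f g)\<rparr>"

definition cocycles1 ::
    "('g, 'm) monoid_scheme \<Rightarrow> ('k, 'v) module \<Rightarrow> ('g \<Rightarrow> 'v \<Rightarrow> 'v) \<Rightarrow> ('g \<Rightarrow> 'v) set" where
  "cocycles1 G V act = {f \<in> carrier G \<rightarrow>\<^sub>E carrier V.
     \<forall>g\<in>carrier G. \<forall>h\<in>carrier G. f (g \<otimes>\<^bsub>G\<^esub> h) = f g \<oplus>\<^bsub>V\<^esub> act g (f h)}"

definition coboundaries1 ::
    "('g, 'm) monoid_scheme \<Rightarrow> ('k, 'v) module \<Rightarrow> ('g \<Rightarrow> 'v \<Rightarrow> 'v) \<Rightarrow> ('g \<Rightarrow> 'v) set" where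
  "coboundaries1 G V act = {\<lambda>g\<in>carrier G. act g v \<ominus>\<^bsub>V\<^esub> v | v. v \<in> carrier V}"

definition quot_module :: "('k, 'v) module \<Rightarrow> 'v set \<Rightarrow> ('k, 'v set) module" where
  "quot_module M N = \<lparr>carrier = a_rcosets\<^bsub>M\<^esub> N,
     mult = undefined, one = undefined,
     zero = N,
     add = set_add M,
     smult = (\<lambda>c X. \<Union>x\<in>X. N +>\<^bsub>M\<^esub> (c \<odot>\<^bsub>M\<^esub> x))\<rparr>"

definition group_H1 ::
    "('g, 'm) monoid_scheme \<Rightarrow> ('k, 'v) module \<Rightarrow> ('g \<Rightarrow> 'v \<Rightarrow> 'v) \<Rightarrow> ('k, ('g \<Rightarrow> 'v) set) module"
  where
  "group_H1 G V act =
     quot_module ((cochains1 G V)\<lparr>carrier := cocycles1 G V act\<rparr>) (coboundaries1 G V act)"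

text \<open>
  \<^const>\<open>vectorspace.dim\<close> is an arbitrary number on spaces that are not finite-dimensional, so
  finite-dimensionality is part of the predicate.
\<close>

definition has_dim :: "('k, 'm) ring_scheme \<Rightarrow> ('k, 'v, 'n) module_scheme \<Rightarrow> nat \<Rightarrow> bool" where
  "has_dim K V n \<longleftrightarrow> vectorspace K V \<and> vectorspace.fin_dim K V \<and> vectorspace.dim K V = n"

end

theory Submission
  imports Defs
begin

text \<open>
  Modulo signs, the group is generated by the unipotent elements $N(u)$ with lower left entry
  $u \in \mathcal{O}_F$ and by $T = \mathrm{diag}(\epsilon, \epsilon^{-1})$, with
  $T N(u) T^{-1} = N(\mu u)$ for $\mu = \epsilon^{-2}$. On the matrix entry $(i,j)$ of $V$ the element $T$
  acts by the weight $\lambda_{ij} = \epsilon^{l_1-2i} \epsilon'^{l_2-2j} = N(\epsilon)^{l_2} \mu^{i-j-m}$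
  with $m = (l_1-l_2)/2$, and every $N(u)$ is unitriangular.

  A cocycle $c$ is normalised entry by entry, column after column. Once all earlier entries of $c$
  gens_zero_before on the generators, $f(u) = c_{ij}(N(u))$ is additive, hence $f(u) = \alpha u + \beta u'$, and
  $f(\mu u) = \lambda_{ij} f(u)$. So $f = 0$ unless $\lambda_{ij} = \mu^{\pm 1}$, and $c_{ij}(T)$ can be removed by a
  coboundary unless $\lambda_{ij} = 1$. The exceptional weights are settled by the entry below:
  for $\lambda_{ij} = \mu^{-1}$ its cocycle relation forces $u f(v) = v f(u)$, so $\beta = 0$; for
  $\lambda_{ij} = 1$ it forces $c_{ij}(T) = 0$, and there the coboundary of the $(i,j)$ matrix unit removes
  the function $\alpha u$ in entry $(i+1,j)$. An entry of weight $1$ has no entry below it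
  only if $l_1 = l_2$ and $(i,j) = (l_1,l_2)$ is the last entry, which is fixed by the group and
  contributes the class of $t \mapsto \log|t|$.
\<close>

section \<open>Real quadratic fields\<close>

text \<open>The order of normalisation matters. Once all columns to the left vanish, N(u) acts on a
  column through powers of u alone, so a correction at (i,j) changes the entry below by a multiple
  of u and never of u'. Weight 1 occurs exactly at i = j + m, when N(epsilon)^l2 = 1. The entry
  below exists there unless j + m = l1 = l2 + 2m, which forces m = 0 and j = l2. Proceeding along
  rows instead would lose the right-hand neighbour at j = l2 for every l1, so the larger factor has
  to be used first. The weights 1 and mu occupy consecutive rows of a column and cannot be treated
  apart: a correction at weight 1 does not affect T there, and this freedom is what removes alpha u
  at weight mu. If N(epsilon)^l2 = -1, every weight is negative and none is exceptional.\<close>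

lemma bounded_denominator_powers_imp_Ints:
  fixes q :: rat and D :: int
  assumes D: "D > 0" and pow: "\<And>k. of_int D * q ^ k \<in> \<int>"
  shows "q \<in> \<int>"
proof -
  obtain a b where ab: "quotient_of q = (a, b)" by fastforce
  have q: "q = of_int a / of_int b" and b: "b > 0" and cop: "coprime a b"
    using quotient_of_div[OF ab] quotient_of_denom_pos[OF ab] quotient_of_coprime[OF ab] by auto
  \<comment> \<open>In lowest terms, integrality of \<open>D * q ^ k\<close> means that
    \<open>b ^ k\<close> divides \<open>D * a ^ k\<close>, and coprimality strips off the
    numerator.\<close>
  have dvd: "b ^ k dvd D" for k
  proof -
    obtain m where "of_int D * q ^ k = (of_int m :: rat)"
      using pow[of k] by (auto elim: Ints_cases)
    hence "(of_int (D * a ^ k) :: rat) = of_int (m * b ^ k)"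
      using b by (simp add: q power_divide field_simps)
    hence "D * a ^ k = m * b ^ k" by (simp only: of_int_eq_iff)
    hence "b ^ k dvd D * a ^ k" by simp
    moreover have "coprime (b ^ k) (a ^ k)" using cop by (simp add: coprime_commute)
    ultimately show ?thesis by (simp add: coprime_dvd_mult_left_iff)
  qed
  have "b = 1"
  proof (rule ccontr)
    assume "b \<noteq> 1"
    hence "b \<ge> 2" using b by simp
    \<comment> \<open>The exponent D already gives the contradiction D < 2^D <= b^D <= D.\<close>
    have "int (nat D) < 2 ^ nat D" using of_nat_less_two_power by blast
    also have "\<dots> \<le> b ^ nat D" using \<open>b \<ge> 2\<close> by (intro power_mono) auto
    also have "\<dots> \<le> D" using dvd D by (intro zdvd_imp_le) auto
    finally show False using D by simp
  qed
  thus ?thesis by (simp add: q)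
qed

locale real_quadratic =
  fixes d :: nat
  assumes d_squarefree: "squarefree d" and d_gt_1: "d > 1"
begin

abbreviation \<delta> :: real where "\<delta> \<equiv> sqrt (real d)"
abbreviation cj :: "real \<Rightarrow> real" where "cj \<equiv> quad_conj d"
abbreviation \<O> :: "real set" where "\<O> \<equiv> quad_ints d"

lemma sqrt_d_sq [simp]: "\<delta> * \<delta> = real d" by simp

text \<open>A rational algebraic integer is an integer, and then d would be a perfect square greater
  than 1.\<close>

lemma sqrt_d_irrational: "\<delta> \<notin> \<rat>"
proof
  assume "\<delta> \<in> \<rat>"
  moreover have "algebraic_int \<delta>" by (intro algebraic_int_sqrt int_imp_algebraic_int) auto
  ultimately have "\<delta> \<in> \<int>" by (rule rational_algebraic_int_is_int[rotated])
  then obtain n where n: "\<delta> = of_int n" by (auto elim: Ints_cases)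
  have "real d = of_int (n * n)" by (metis n of_int_mult sqrt_d_sq)
  hence "int d = n * n" by linarith
  hence "d = nat \<bar>n\<bar> ^ 2" by (simp add: power2_eq_square nat_mult_distrib[symmetric] flip: abs_mult)
  hence "nat \<bar>n\<bar> dvd 1" using d_squarefree unfolding squarefree_def by auto
  thus False using \<open>d = nat \<bar>n\<bar> ^ 2\<close> d_gt_1 by simp
qed

lemma quad_repr_unique:
  assumes "of_rat a + of_rat b * \<delta> = of_rat a' + of_rat b' * \<delta>"
  shows "a = a' \<and> b = b'"
proof -
  have e: "of_rat (b - b') * \<delta> = of_rat (a' - a)" using assms by (simp add: of_rat_diff algebra_simps)
  have "b = b'"
  proof (rule ccontr)
    assume "b \<noteq> b'"
    hence "\<delta> = of_rat ((a' - a) / (b - b'))" using e by (simp add: of_rat_divide field_simps)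
    thus False using sqrt_d_irrational by (metis Rats_of_rat)
  qed
  thus ?thesis using e by simp
qed

lemma quad_conj_eq [simp]: "cj (of_rat a + of_rat b * \<delta>) = of_rat a - of_rat b * \<delta>"
  unfolding quad_conj_def using quad_repr_unique by (intro the_equality) blast+

lemma quad_fieldE:
  assumes "x \<in> quad_field d"
  obtains a b where "x = of_rat a + of_rat b * \<delta>" "cj x = of_rat a - of_rat b * \<delta>"
  using assms unfolding quad_field_def by force

lemma quad_fieldI: "of_rat a + of_rat b * \<delta> \<in> quad_field d"
  unfolding quad_field_def by blast

lemma quad_field_add:
  assumes "x \<in> quad_field d" "y \<in> quad_field d"
  shows "x + y \<in> quad_field d" "cj (x + y) = cj x + cj y"
proof -
  obtain a b where x: "x = of_rat a + of_rat b * \<delta>" "cj x = of_rat a - of_rat b * \<delta>"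
    using quad_fieldE[OF assms(1)] .
  obtain a' b' where y: "y = of_rat a' + of_rat b' * \<delta>" "cj y = of_rat a' - of_rat b' * \<delta>"
    using quad_fieldE[OF assms(2)] .
  have e: "x + y = of_rat (a + a') + of_rat (b + b') * \<delta>"
    by (simp add: x y of_rat_add algebra_simps)
  show "x + y \<in> quad_field d" unfolding e by (rule quad_fieldI)
  show "cj (x + y) = cj x + cj y" unfolding e quad_conj_eq by (simp add: x y of_rat_add algebra_simps)
qed

lemma quad_field_mult:
  assumes "x \<in> quad_field d" "y \<in> quad_field d"
  shows "x * y \<in> quad_field d" "cj (x * y) = cj x * cj y"
proof -
  obtain a b where x: "x = of_rat a + of_rat b * \<delta>" "cj x = of_rat a - of_rat b * \<delta>"
    using quad_fieldE[OF assms(1)] .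
  obtain a' b' where y: "y = of_rat a' + of_rat b' * \<delta>" "cj y = of_rat a' - of_rat b' * \<delta>"
    using quad_fieldE[OF assms(2)] .
  \<comment> \<open>\<open>algebra_simps\<close> produces right-nested products; in this form two
    factors sqrt d are still recognised inside them.\<close>
  have dd: "\<delta> * (\<delta> * z) = of_rat (of_nat d) * z" for z
    by (simp flip: mult.assoc)
  have e: "x * y = of_rat (a * a' + b * b' * of_nat d) + of_rat (a * b' + a' * b) * \<delta>"
    by (simp add: x y of_rat_add of_rat_mult algebra_simps dd)
  show "x * y \<in> quad_field d" unfolding e by (rule quad_fieldI)
  show "cj (x * y) = cj x * cj y"
    unfolding e quad_conj_eq by (simp add: x y of_rat_add of_rat_mult algebra_simps dd)
qed

lemma quad_field_of_rat: "of_rat a \<in> quad_field d" "cj (of_rat a) = of_rat a"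
  using quad_fieldI[of a 0] quad_conj_eq[of a 0] by simp_all

lemma quad_field_of_int: "of_int n \<in> quad_field d" "cj (of_int n) = of_int n"
  using quad_field_of_rat[of "of_int n"] by simp_all

lemma quad_conj_0 [simp]: "cj 0 = 0" and quad_conj_1 [simp]: "cj 1 = 1"
  using quad_field_of_int(2)[of 0] quad_field_of_int(2)[of 1] by simp_all

lemma quad_field_sqrt_d: "\<delta> \<in> quad_field d" and quad_conj_sqrt_d [simp]: "cj \<delta> = - \<delta>"
  using quad_fieldI[of 0 1] quad_conj_eq[of 0 1] by simp_all

lemma quad_field_minus:
  assumes "x \<in> quad_field d"
  shows "- x \<in> quad_field d" "cj (- x) = - cj x"
  using quad_field_mult[OF quad_field_of_int(1)[of "-1"] assms] quad_field_of_int(2)[of "-1"] by auto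

lemma quad_norm_of_rat:
  assumes "x \<in> quad_field d"
  obtains n where "quad_norm d x = of_rat n"
proof -
  obtain a b where x: "x = of_rat a + of_rat b * \<delta>" "cj x = of_rat a - of_rat b * \<delta>"
    using quad_fieldE[OF assms] .
  have "quad_norm d x = of_rat (a * a - b * b * of_nat d)"
    unfolding quad_norm_def x by (simp add: of_rat_diff of_rat_mult algebra_simps)
  thus ?thesis using that by blast
qed

section \<open>Integrality through bounded denominators over Z[sqrt d]\<close>

definition quad_order :: "real set" where "quad_order = {of_int a + of_int b * \<delta> | a b. True}"

lemma quad_order_int: "of_int a \<in> quad_order"
  unfolding quad_order_def by (rule CollectI) (metis add.right_neutral mult_zero_left of_int_0)

lemma quad_order_add: "x \<in> quad_order \<Longrightarrow> y \<in> quad_order \<Longrightarrow> x + y \<in> quad_order"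
proof -
  assume "x \<in> quad_order" "y \<in> quad_order"
  then obtain a b a' b' where "x = of_int a + of_int b * \<delta>" "y = of_int a' + of_int b' * \<delta>"
    unfolding quad_order_def by blast
  hence "x + y = of_int (a + a') + of_int (b + b') * \<delta>" by (simp add: algebra_simps)
  thus ?thesis unfolding quad_order_def by blast
qed

lemma quad_order_mult: "x \<in> quad_order \<Longrightarrow> y \<in> quad_order \<Longrightarrow> x * y \<in> quad_order"
proof -
  assume "x \<in> quad_order" "y \<in> quad_order"
  then obtain a b a' b' where "x = of_int a + of_int b * \<delta>" "y = of_int a' + of_int b' * \<delta>"
    unfolding quad_order_def by blast
  hence "x * y = of_int (a * a' + b * b' * int d) + of_int (a * b' + a' * b) * \<delta>"
    by (simp add: algebra_simps)
  thus ?thesis unfolding quad_order_def by blast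
qed

lemma quad_order_sum: "(\<And>i. i \<in> I \<Longrightarrow> f i \<in> quad_order) \<Longrightarrow> sum f I \<in> quad_order"
  using quad_order_int[of 0] by (induction I rule: infinite_finite_induct) (auto intro: quad_order_add)

lemma quad_order_norm_int:
  assumes "x \<in> quad_order"
  shows "x * cj x \<in> \<int>"
proof -
  obtain a b where x: "x = of_int a + of_int b * \<delta>" using assms unfolding quad_order_def by blast
  have "cj x = of_int a - of_int b * \<delta>"
    using quad_conj_eq[of "of_int a" "of_int b"] x by simp
  hence "x * cj x = (of_int a + of_int b * \<delta>) * (of_int a - of_int b * \<delta>)" using x by simp
  also have "\<dots> = of_int (a * a - b * b * int d)" by (simp add: algebra_simps)
  finally have "x * cj x = of_int (a * a - b * b * int d)" .
  thus ?thesis by (metis Ints_of_int)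
qed

lemma quad_field_denominator:
  assumes "x \<in> quad_field d"
  obtains D :: int where "D > 0" "of_int D * x \<in> quad_order"
proof -
  obtain a b where x: "x = of_rat a + of_rat b * \<delta>" using quad_fieldE[OF assms] by metis
  obtain p q where a: "quotient_of a = (p, q)" by fastforce
  obtain p' q' where b: "quotient_of b = (p', q')" by fastforce
  have q: "q > 0" "q' > 0" and ab: "a = of_int p / of_int q" "b = of_int p' / of_int q'"
    using quotient_of_denom_pos[OF a] quotient_of_denom_pos[OF b] quotient_of_div[OF a] quotient_of_div[OF b]
    by auto
  have "of_int (q * q') * x = of_int (p * q') + of_int (p' * q) * \<delta>"
    using q by (simp add: x ab of_rat_divide field_simps)
  hence "of_int (q * q') * x \<in> quad_order" unfolding quad_order_def by blast
  with q that show ?thesis by (metis mult_pos_pos)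
qed

text \<open>
  For elements of the field this is equivalent to integrality, and closure under sums and products is
  immediate; both the ring structure of $\mathcal{O}_F$ and the integrality of norms come from it.
\<close>

definition bdd_denom :: "real \<Rightarrow> bool" where
  "bdd_denom x \<longleftrightarrow> x \<in> quad_field d \<and> (\<exists>D::int. D > 0 \<and> (\<forall>k. of_int D * x ^ k \<in> quad_order))"

text \<open>By the binomial theorem \<open>D * E\<close> clears all terms x^i y^(k-i) at
  once.\<close>

lemma bdd_denom_add:
  assumes "bdd_denom x" "bdd_denom y"
  shows "bdd_denom (x + y)"
proof -
  obtain D E :: int where D: "D > 0" "\<And>k. of_int D * x ^ k \<in> quad_order" and E: "E > 0" "\<And>k. of_int E * y ^ k \<in> quad_order"
    using assms unfolding bdd_denom_def by blast
  have "of_int (D * E) * (x + y) ^ k \<in> quad_order" for k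
  proof -
    have "of_int (D * E) * (x + y) ^ k =
      (\<Sum>i\<le>k. of_int (int (k choose i)) * ((of_int D * x ^ i) * (of_int E * y ^ (k - i))))"
      by (simp add: binomial_ring sum_distrib_left mult_ac)
    also have "\<dots> \<in> quad_order" by (intro quad_order_sum quad_order_mult quad_order_int D E)
    finally show ?thesis .
  qed
  moreover have "D * E > 0" using D E by simp
  ultimately show ?thesis using assms quad_field_add unfolding bdd_denom_def by blast
qed

lemma bdd_denom_mult:
  assumes "bdd_denom x" "bdd_denom y"
  shows "bdd_denom (x * y)"
proof -
  obtain D E :: int where D: "D > 0" "\<And>k. of_int D * x ^ k \<in> quad_order" and E: "E > 0" "\<And>k. of_int E * y ^ k \<in> quad_order"
    using assms unfolding bdd_denom_def by blast
  have "of_int (D * E) * (x * y) ^ k \<in> quad_order" for k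
    using quad_order_mult[OF D(2)[of k] E(2)[of k]] by (simp add: power_mult_distrib mult_ac)
  moreover have "D * E > 0" using D E by simp
  ultimately show ?thesis using assms quad_field_mult unfolding bdd_denom_def by blast
qed

lemma quad_field_power:
  assumes "x \<in> quad_field d"
  shows "x ^ k \<in> quad_field d \<and> cj (x ^ k) = cj x ^ k"
  using quad_field_of_int[of 1] quad_field_mult[OF assms] by (induction k) auto

text \<open>The norm is a rational n, and D^2 n^k is the norm of D x^k, an element of Z[sqrt d]. So
  it is an integer for every k, and the bounded denominator makes n itself an integer.\<close>

lemma bdd_denom_norm_int:
  assumes "bdd_denom x"
  shows "x * cj x \<in> \<int>"
proof -
  have F: "x \<in> quad_field d" using assms unfolding bdd_denom_def by blast
  obtain D :: int where D: "D > 0" "\<And>k. of_int D * x ^ k \<in> quad_order"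
    using assms unfolding bdd_denom_def by blast
  obtain n where n: "x * cj x = of_rat n" using quad_norm_of_rat[OF F] unfolding quad_norm_def by blast
  have "of_int (D * D) * n ^ k \<in> \<int>" for k
  proof -
    have c: "cj (of_int D * x ^ k) = of_int D * cj x ^ k"
      using quad_field_mult(2)[OF quad_field_of_int(1)] quad_field_power[OF F] quad_field_of_int(2) by simp
    have "(of_int D * x ^ k) * cj (of_int D * x ^ k) = of_int (D * D) * (x * cj x) ^ k"
      unfolding c by (simp add: power_mult_distrib mult_ac)
    also have "\<dots> = of_rat (of_int (D * D) * n ^ k)"
      unfolding n by (simp add: of_rat_mult of_rat_power)
    finally have "(of_rat (of_int (D * D) * n ^ k) :: real) \<in> \<int>" using quad_order_norm_int[OF D(2)] by metis
    then obtain m where "(of_rat (of_int (D * D) * n ^ k) :: real) = of_int m" by (auto elim: Ints_cases)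
    hence "(of_rat (of_int (D * D) * n ^ k) :: real) = of_rat (of_int m)" by simp
    thus ?thesis by (metis Ints_of_int of_rat_eq_iff)
  qed
  moreover have "D * D > 0" using D by simp
  ultimately have "n \<in> \<int>" by (rule bounded_denominator_powers_imp_Ints[rotated])
  thus ?thesis unfolding n by (auto elim!: Ints_cases)
qed

text \<open>Integrality of the trace is read off from norms: it is N(x + 1) - N(x) - 1. With norm
  and trace integral, x is a root of a monic integral quadratic.\<close>

lemma bdd_denom_imp_algebraic_int:
  assumes "bdd_denom x"
  shows "algebraic_int x"
proof -
  have F: "x \<in> quad_field d" using assms unfolding bdd_denom_def by blast
  have 1: "bdd_denom 1"
    unfolding bdd_denom_def using quad_field_of_int(1)[of 1] quad_order_int[of 1] by (auto intro!: exI[of _ 1])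
  have N: "x * cj x \<in> \<int>" by (rule bdd_denom_norm_int[OF assms])
  have "(x + 1) * cj (x + 1) \<in> \<int>" by (rule bdd_denom_norm_int[OF bdd_denom_add[OF assms 1]])
  hence "(x + 1) * (cj x + 1) \<in> \<int>" using quad_field_add(2)[OF F quad_field_of_int(1)[of 1]] by simp
  hence "(x + 1) * (cj x + 1) - x * cj x - 1 \<in> \<int>" using N by (intro Ints_diff) auto
  hence T: "x + cj x \<in> \<int>" by (simp add: algebra_simps)
  let ?p = "[:x * cj x, - (x + cj x), 1:]"
  have "coeff ?p i \<in> \<int>" for i
    using N T Ints_minus[OF T] by (auto simp: coeff_pCons split: nat.split)
  moreover have "lead_coeff ?p = 1" "poly ?p x = 0" by (simp_all add: algebra_simps)
  ultimately show ?thesis by (blast intro: algebraic_int.intros)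
qed

text \<open>One denominator serves the finitely many powers below the degree n; the monic equation
  rewrites each higher power as an integral combination of smaller ones.\<close>

lemma algebraic_int_imp_bdd_denom:
  assumes F: "x \<in> quad_field d" and "algebraic_int x"
  shows "bdd_denom x"
proof -
  from assms(2) obtain p where p: "lead_coeff p = 1" "\<And>i. coeff p i \<in> \<int>" "poly p x = 0"
    by (auto elim: algebraic_int.cases)
  define n where "n = degree p"
  have "\<exists>D::int. D > 0 \<and> (\<forall>k<m. of_int D * x ^ k \<in> quad_order)" for m
  proof (induction m)
    case 0 show ?case by (rule exI[of _ 1]) simp
  next
    case (Suc m)
    then obtain D :: int where D: "D > 0" "\<And>k. k < m \<Longrightarrow> of_int D * x ^ k \<in> quad_order" by blast
    obtain E :: int where E: "E > 0" "of_int E * x ^ m \<in> quad_order"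
      using quad_field_denominator quad_field_power[OF F] by metis
    have "of_int (D * E) * x ^ k \<in> quad_order" if "k < Suc m" for k
    proof (cases "k = m")
      case True
      thus ?thesis using quad_order_mult[OF quad_order_int[of D] E(2)] by (simp add: mult_ac)
    next
      case False
      thus ?thesis using quad_order_mult[OF quad_order_int[of E] D(2)[of k]] that by (simp add: mult_ac)
    qed
    moreover have "D * E > 0" using D E by simp
    ultimately show ?case by blast
  qed
  then obtain D :: int where D: "D > 0" "\<And>k. k < n \<Longrightarrow> of_int D * x ^ k \<in> quad_order" by blast
  have "of_int D * x ^ k \<in> quad_order" for k
  proof (induction k rule: less_induct)
    case (less k)
    show ?case
    proof (cases "k < n")
      case False
      have "poly p x = (\<Sum>i<n. coeff p i * x ^ i) + x ^ n"
        using p(1) unfolding poly_altdef n_def by (simp flip: lessThan_Suc_atMost)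
      hence xn: "x ^ n = (\<Sum>i<n. - coeff p i * x ^ i)" using p(3) by (simp add: sum_negf)
      have "of_int D * x ^ k = of_int D * (x ^ (k - n) * x ^ n)"
        using False by (simp flip: power_add)
      also have "\<dots> = (\<Sum>i<n. - coeff p i * (of_int D * x ^ (k - n + i)))"
        unfolding xn by (simp add: sum_distrib_left power_add mult_ac)
      also have "\<dots> \<in> quad_order"
      proof (rule quad_order_sum)
        fix i assume "i \<in> {..<n}"
        hence "k - n + i < k" using False by auto
        moreover have "- coeff p i \<in> quad_order" using Ints_minus[OF p(2)[of i]] quad_order_int by (metis Ints_cases)
        ultimately show "- coeff p i * (of_int D * x ^ (k - n + i)) \<in> quad_order" by (intro quad_order_mult less)
      qed
      finally show ?thesis .
    qed (use D in auto)
  qed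
  thus ?thesis using F D(1) unfolding bdd_denom_def by blast
qed

lemma quad_ints_iff_bdd_denom: "x \<in> \<O> \<longleftrightarrow> bdd_denom x"
  unfolding quad_ints_def using algebraic_int_imp_bdd_denom bdd_denom_imp_algebraic_int
  by (auto simp: bdd_denom_def)

section \<open>The ring of integers, norms of units, additive functions\<close>

lemma quad_ints_field: "x \<in> \<O> \<Longrightarrow> x \<in> quad_field d"
  unfolding quad_ints_def by simp

lemma quad_ints_add: "x \<in> \<O> \<Longrightarrow> y \<in> \<O> \<Longrightarrow> x + y \<in> \<O>"
  unfolding quad_ints_iff_bdd_denom by (rule bdd_denom_add)

lemma quad_ints_mult: "x \<in> \<O> \<Longrightarrow> y \<in> \<O> \<Longrightarrow> x * y \<in> \<O>"
  unfolding quad_ints_iff_bdd_denom by (rule bdd_denom_mult)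

lemma quad_ints_minus: "x \<in> \<O> \<Longrightarrow> - x \<in> \<O>"
  unfolding quad_ints_def using quad_field_minus by auto

lemma quad_ints_of_int: "of_int n \<in> \<O>"
  unfolding quad_ints_def using quad_field_of_int by (auto intro: int_imp_algebraic_int)

lemma quad_ints_0 [simp]: "0 \<in> \<O>" and quad_ints_1 [simp]: "1 \<in> \<O>"
  using quad_ints_of_int[of 0] quad_ints_of_int[of 1] by simp_all

lemma quad_ints_sqrt_d [simp]: "\<delta> \<in> \<O>"
  unfolding quad_ints_def using quad_field_sqrt_d by (auto intro: int_imp_algebraic_int)

lemma quad_conj_add: "x \<in> \<O> \<Longrightarrow> y \<in> \<O> \<Longrightarrow> cj (x + y) = cj x + cj y"
  by (intro quad_field_add quad_ints_field)

lemma quad_conj_mult: "x \<in> \<O> \<Longrightarrow> y \<in> \<O> \<Longrightarrow> cj (x * y) = cj x * cj y"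
  by (intro quad_field_mult quad_ints_field)

lemma quad_conj_minus: "x \<in> \<O> \<Longrightarrow> cj (- x) = - cj x"
  by (intro quad_field_minus quad_ints_field)

lemma quad_units_norm:
  assumes "t \<in> quad_units d"
  shows "quad_norm d t = 1 \<or> quad_norm d t = -1"
proof -
  from assms obtain s where ts: "t \<in> \<O>" "s \<in> \<O>" "t * s = 1" unfolding quad_units_def by blast
  obtain m n where mn: "t * cj t = of_int m" "s * cj s = of_int n"
    using bdd_denom_norm_int ts unfolding quad_ints_iff_bdd_denom by (metis Ints_cases)
  have "(t * s) * cj (t * s) = (t * cj t) * (s * cj s)"
    using quad_conj_mult[OF ts(1,2)] by (simp add: mult_ac)
  hence "of_int (m * n) = (1 :: real)" using mn ts(3) by simp
  hence "m * n = 1" by linarith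
  hence "m = 1 \<or> m = -1" by (auto simp: zmult_eq_1_iff)
  thus ?thesis using mn unfolding quad_norm_def by auto
qed

text \<open>alpha and beta are fitted at 1 and sqrt d. The remainder g is additive and vanishes on
  Z[sqrt d]; some positive multiple D u lies there, so D g(u) = 0.\<close>

lemma additive_on_quad_ints:
  fixes f :: "real \<Rightarrow> complex"
  assumes add: "\<And>u v. u \<in> \<O> \<Longrightarrow> v \<in> \<O> \<Longrightarrow> f (u + v) = f u + f v"
  obtains \<alpha> \<beta> where "\<And>u. u \<in> \<O> \<Longrightarrow> f u = \<alpha> * of_real u + \<beta> * of_real (cj u)"
proof -
  define \<alpha> where "\<alpha> = (f 1 + f \<delta> / of_real \<delta>) / 2"
  define \<beta> where "\<beta> = (f 1 - f \<delta> / of_real \<delta>) / 2"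
  define g where "g u = f u - (\<alpha> * of_real u + \<beta> * of_real (cj u))" for u
  have dn: "\<delta> \<noteq> 0" using d_gt_1 by simp
  have g_add: "g (u + v) = g u + g v" if "u \<in> \<O>" "v \<in> \<O>" for u v
    using that by (simp add: g_def add quad_conj_add algebra_simps)
  have "g 0 = 0" using g_add[of 0 0] by simp
  have g_minus: "g (- u) = - g u" if "u \<in> \<O>" for u
    using g_add[of u "- u"] quad_ints_minus[OF that] that \<open>g 0 = 0\<close> by (simp add: add_eq_0_iff)
  have g_nat: "g (of_nat n * u) = of_nat n * g u \<and> of_nat n * u \<in> \<O>" if "u \<in> \<O>" for n u
  proof (induction n)
    case (Suc n)
    thus ?case using g_add[of u "of_nat n * u"] quad_ints_add that by (simp add: algebra_simps)
  qed (simp add: \<open>g 0 = 0\<close>)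
  have g_int: "g (of_int n * u) = of_int n * g u" if "u \<in> \<O>" for n u
    using g_nat[OF that] g_minus by (cases n rule: int_cases2) auto
  have g1: "g 1 = 0" by (simp add: g_def \<alpha>_def \<beta>_def field_simps)
  have gd: "g \<delta> = 0" using dn by (simp add: g_def \<alpha>_def \<beta>_def field_simps)
  have gZD: "g x = 0" if xZD: "x \<in> quad_order" for x
  proof -
    obtain a b where "x = of_int a + of_int b * \<delta>" using xZD unfolding quad_order_def by blast
    hence x: "x = of_int a * 1 + of_int b * \<delta>" by simp
    show ?thesis unfolding x
      using g_add[OF quad_ints_mult[OF quad_ints_of_int quad_ints_1] quad_ints_mult[OF quad_ints_of_int quad_ints_sqrt_d]]
        g_int[of 1 a] g_int[of \<delta> b] g1 gd by simp
  qed
  have "g u = 0" if u: "u \<in> \<O>" for u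
  proof -
    obtain D :: int where "D > 0" "of_int D * u \<in> quad_order"
      using quad_field_denominator[OF quad_ints_field[OF u]] .
    thus ?thesis using gZD g_int[OF u, of D] by simp
  qed
  thus ?thesis using that unfolding g_def by (metis eq_iff_diff_eq_0)
qed

text \<open>Evaluation at 1 and at sqrt d gives alpha + beta = 0 and alpha - beta = 0.\<close>

lemma quad_conj_independent:
  assumes "\<And>u. u \<in> \<O> \<Longrightarrow> (\<alpha> :: complex) * of_real u + \<beta> * of_real (cj u) = 0"
  shows "\<alpha> = 0" "\<beta> = 0"
proof -
  have dn: "\<delta> \<noteq> 0" using d_gt_1 by simp
  have 1: "\<alpha> + \<beta> = 0" using assms[of 1] by simp
  have "(\<alpha> - \<beta>) * of_real \<delta> = 0" using assms[of \<delta>] by (simp add: algebra_simps)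
  hence 2: "\<alpha> - \<beta> = 0" using dn by simp
  have "2 * \<alpha> = (\<alpha> + \<beta>) + (\<alpha> - \<beta>)" by simp
  thus "\<alpha> = 0" using 1 2 by simp
  thus "\<beta> = 0" using 1 by simp
qed

end

section \<open>The vector space of first cohomology classes\<close>

context
  fixes K :: "('k, 'r) ring_scheme" and M :: "('k, 'v) module" and N :: "'v set"
  assumes vs: "vectorspace K M" and sub: "LinearCombinations.submodule K N M"
begin

interpretation M: vectorspace K M by (rule vs)
interpretation N: LinearCombinations.submodule K N M by (rule sub)

text \<open>Makes the coset calculus of \<open>abelian_subgroup\<close> available; negatives are
  multiples by -1.\<close>

lemma submodule_abelian_subgroup: "abelian_subgroup N M"
proof -
  have "subgroup N (add_monoid M)"
  proof (rule M.add.subgroupI)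
    fix a assume a: "a \<in> N"
    hence "\<ominus>\<^bsub>M\<^esub> a = (\<ominus>\<^bsub>K\<^esub> \<one>\<^bsub>K\<^esub>) \<odot>\<^bsub>M\<^esub> a"
      using N.subset by (simp add: subsetD M.smult_l_minus)
    also have "\<dots> \<in> N" using a by (intro N.smult_closed) auto
    finally show "\<ominus>\<^bsub>M\<^esub> a \<in> N" .
  qed (use N.subset N.zero_closed N.m_closed in blast)+
  thus ?thesis by (intro abelian_subgroupI3 additive_subgroupI M.M.abelian_group_axioms)
qed

interpretation A: abelian_subgroup N M by (rule submodule_abelian_subgroup)

text \<open>The union in \<open>quot_module\<close> runs over the representatives of one coset. They
  differ by elements of N, so all cosets in the union coincide.\<close>

lemma quot_module_smult:
  assumes c: "c \<in> carrier K" and x: "x \<in> carrier M"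
  shows "c \<odot>\<^bsub>quot_module M N\<^esub> (N +>\<^bsub>M\<^esub> x) = N +>\<^bsub>M\<^esub> (c \<odot>\<^bsub>M\<^esub> x)"
proof -
  have const: "N +>\<^bsub>M\<^esub> (c \<odot>\<^bsub>M\<^esub> y) = N +>\<^bsub>M\<^esub> (c \<odot>\<^bsub>M\<^esub> x)" if y: "y \<in> N +>\<^bsub>M\<^esub> x" for y
  proof -
    have yc: "y \<in> carrier M" by (rule A.a_elemrcos_carrier[OF x y])
    have "y \<oplus>\<^bsub>M\<^esub> \<ominus>\<^bsub>M\<^esub> x \<in> N" by (rule A.a_rcos_module_imp[OF x y])
    hence "c \<odot>\<^bsub>M\<^esub> (y \<oplus>\<^bsub>M\<^esub> \<ominus>\<^bsub>M\<^esub> x) \<in> N" using c by auto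
    hence "c \<odot>\<^bsub>M\<^esub> y \<oplus>\<^bsub>M\<^esub> \<ominus>\<^bsub>M\<^esub> (c \<odot>\<^bsub>M\<^esub> x) \<in> N"
      using c x yc by (simp add: M.smult_r_distr M.smult_r_minus)
    hence "c \<odot>\<^bsub>M\<^esub> y \<in> N +>\<^bsub>M\<^esub> (c \<odot>\<^bsub>M\<^esub> x)" using c x yc by (intro A.a_rcos_module_rev) auto
    thus ?thesis using c x by (intro A.a_repr_independence'[symmetric]) auto
  qed
  have "N +>\<^bsub>M\<^esub> x \<noteq> {}" using A.a_rcos_self[OF x] by blast
  hence "(\<Union>y\<in>N +>\<^bsub>M\<^esub> x. N +>\<^bsub>M\<^esub> (c \<odot>\<^bsub>M\<^esub> y)) = N +>\<^bsub>M\<^esub> (c \<odot>\<^bsub>M\<^esub> x)"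
    using const by (rule SUP_eq_const)
  thus ?thesis by (simp add: quot_module_def)
qed

lemma quot_module_carrierE:
  assumes "X \<in> carrier (quot_module M N)"
  obtains x where "x \<in> carrier M" "X = N +>\<^bsub>M\<^esub> x"
  using assms unfolding quot_module_def by (auto simp: A_RCOSETS_def')

lemma quot_module_carrierI: "x \<in> carrier M \<Longrightarrow> N +>\<^bsub>M\<^esub> x \<in> carrier (quot_module M N)"
  unfolding quot_module_def by (auto simp: A_RCOSETS_def')

lemma quot_module_add:
  "x \<in> carrier M \<Longrightarrow> y \<in> carrier M \<Longrightarrow>
    (N +>\<^bsub>M\<^esub> x) \<oplus>\<^bsub>quot_module M N\<^esub> (N +>\<^bsub>M\<^esub> y) = N +>\<^bsub>M\<^esub> (x \<oplus>\<^bsub>M\<^esub> y)"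
  unfolding quot_module_def using A.a_rcos_sum by simp

lemma quot_module_zero: "\<zero>\<^bsub>quot_module M N\<^esub> = N +>\<^bsub>M\<^esub> \<zero>\<^bsub>M\<^esub>"
  unfolding quot_module_def using A.a_rcos_const[OF A.zero_closed] by simp

lemma vectorspace_quot_module: "vectorspace K (quot_module M N)"
proof -
  have "abelian_group (quot_module M N)"
  proof (rule abelian_groupI)
    fix X assume "X \<in> carrier (quot_module M N)"
    then obtain x where x: "x \<in> carrier M" "X = N +>\<^bsub>M\<^esub> x" by (rule quot_module_carrierE)
    have "(N +>\<^bsub>M\<^esub> (\<ominus>\<^bsub>M\<^esub> x)) \<oplus>\<^bsub>quot_module M N\<^esub> X = \<zero>\<^bsub>quot_module M N\<^esub>"
      using x by (simp add: quot_module_add quot_module_zero M.l_neg)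
    thus "\<exists>y\<in>carrier (quot_module M N). y \<oplus>\<^bsub>quot_module M N\<^esub> X = \<zero>\<^bsub>quot_module M N\<^esub>"
      using x quot_module_carrierI by blast
  qed (auto elim!: quot_module_carrierE intro!: quot_module_carrierI
        simp: quot_module_add quot_module_zero M.M.add.m_ac)
  hence "module K (quot_module M N)"
    by (intro moduleI M.R.cring_axioms)
      (auto elim!: quot_module_carrierE intro!: quot_module_carrierI
        simp: quot_module_add quot_module_smult M.smult_l_distr M.smult_r_distr M.smult_assoc1)
  thus ?thesis by (intro vectorspace.intro M.field_axioms)
qed

lemma has_dim_quot_module_0:
  assumes "N = carrier M"
  shows "has_dim K (quot_module M N) 0"
proof -
  interpret Q: vectorspace K "quot_module M N" by (rule vectorspace_quot_module)
  have "X = \<zero>\<^bsub>quot_module M N\<^esub>" if "X \<in> carrier (quot_module M N)" for X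
    using that A.a_rcos_const assms by (elim quot_module_carrierE) (simp add: quot_module_def)
  hence c: "carrier (quot_module M N) = {\<zero>\<^bsub>quot_module M N\<^esub>}" by auto
  have g: "Q.gen_set {\<zero>\<^bsub>quot_module M N\<^esub>}"
    using Q.span_is_subset2[of "{\<zero>\<^bsub>quot_module M N\<^esub>}"] Q.in_own_span[of "{\<zero>\<^bsub>quot_module M N\<^esub>}"] c by auto
  have "Q.fin_dim" unfolding Q.fin_dim_def using g by (intro exI[of _ "{\<zero>\<^bsub>quot_module M N\<^esub>}"]) auto
  thus ?thesis using Q.dim0I[OF g] Q.vectorspace_axioms unfolding has_dim_def by blast
qed

text \<open>The coset of z spans, and it is nonzero because z lies outside N. The hypotheses speak
  of representatives, which is how cocycles are given.\<close>

lemma has_dim_quot_module_1: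
  assumes z: "z \<in> carrier M" "z \<notin> N"
    and gen: "\<And>x. x \<in> carrier M \<Longrightarrow> \<exists>c\<in>carrier K. \<exists>n\<in>N. x = n \<oplus>\<^bsub>M\<^esub> c \<odot>\<^bsub>M\<^esub> z"
  shows "has_dim K (quot_module M N) 1"
proof -
  interpret Q: vectorspace K "quot_module M N" by (rule vectorspace_quot_module)
  let ?z = "N +>\<^bsub>M\<^esub> z"
  have zc: "?z \<in> carrier (quot_module M N)" using z by (intro quot_module_carrierI)
  have "?z \<noteq> \<zero>\<^bsub>quot_module M N\<^esub>"
    using A.a_rcos_self[OF z(1)] z(2) by (auto simp: quot_module_def)
  have "X \<in> Q.span {?z}" if X: "X \<in> carrier (quot_module M N)" for X
  proof -
    obtain x where x: "x \<in> carrier M" "X = N +>\<^bsub>M\<^esub> x" using X by (rule quot_module_carrierE)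
    obtain c n where cn: "c \<in> carrier K" "n \<in> N" "x = n \<oplus>\<^bsub>M\<^esub> c \<odot>\<^bsub>M\<^esub> z" using gen[OF x(1)] by blast
    have "x \<in> N +>\<^bsub>M\<^esub> (c \<odot>\<^bsub>M\<^esub> z)"
      unfolding cn(3) using cn(2) by (auto simp: a_r_coset_def')
    hence "X = N +>\<^bsub>M\<^esub> (c \<odot>\<^bsub>M\<^esub> z)"
      unfolding x(2) using cn z by (intro A.a_repr_independence'[symmetric]) auto
    hence "X = c \<odot>\<^bsub>quot_module M N\<^esub> ?z" using cn z by (simp add: quot_module_smult)
    moreover have "?z \<in> Q.span {?z}" using Q.in_own_span[of "{?z}"] zc by auto
    ultimately show ?thesis using Q.span_is_submodule[of "{?z}"] zc cn(1)
      unfolding LinearCombinations.submodule_def by auto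
  qed
  hence g: "Q.gen_set {?z}" using Q.span_is_subset2[of "{?z}"] zc by auto
  have "Q.fin_dim" unfolding Q.fin_dim_def using g zc by (intro exI[of _ "{?z}"]) auto
  thus ?thesis using Q.dim1I[OF g] \<open>?z \<noteq> _\<close> zc Q.vectorspace_axioms unfolding has_dim_def by blast
qed

end

section \<open>Cocycles and coboundaries of a linear action\<close>

locale linear_group_action = vectorspace K V
  for K :: "('k, 'r) ring_scheme" and V :: "('k, 'v) module" +
  fixes G :: "('g, 'm) monoid_scheme" and act :: "'g \<Rightarrow> 'v \<Rightarrow> 'v"
  assumes G_closed: "g \<in> carrier G \<Longrightarrow> h \<in> carrier G \<Longrightarrow> g \<otimes>\<^bsub>G\<^esub> h \<in> carrier G"
    and act_closed: "g \<in> carrier G \<Longrightarrow> v \<in> carrier V \<Longrightarrow> act g v \<in> carrier V"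
    and act_add: "g \<in> carrier G \<Longrightarrow> v \<in> carrier V \<Longrightarrow> w \<in> carrier V \<Longrightarrow>
      act g (v \<oplus>\<^bsub>V\<^esub> w) = act g v \<oplus>\<^bsub>V\<^esub> act g w"
    and act_smult: "g \<in> carrier G \<Longrightarrow> c \<in> carrier K \<Longrightarrow> v \<in> carrier V \<Longrightarrow>
      act g (c \<odot>\<^bsub>V\<^esub> v) = c \<odot>\<^bsub>V\<^esub> act g v"
    and act_mult: "g \<in> carrier G \<Longrightarrow> h \<in> carrier G \<Longrightarrow> v \<in> carrier V \<Longrightarrow>
      act (g \<otimes>\<^bsub>G\<^esub> h) v = act g (act h v)"
begin

lemma act_zero: "g \<in> carrier G \<Longrightarrow> act g \<zero>\<^bsub>V\<^esub> = \<zero>\<^bsub>V\<^esub>"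
  using act_smult[of g "\<zero>\<^bsub>K\<^esub>" "\<zero>\<^bsub>V\<^esub>"] act_closed[of g "\<zero>\<^bsub>V\<^esub>"] by simp

lemma act_minus: "g \<in> carrier G \<Longrightarrow> v \<in> carrier V \<Longrightarrow> act g (\<ominus>\<^bsub>V\<^esub> v) = \<ominus>\<^bsub>V\<^esub> act g v"
  using act_smult[of g "\<ominus>\<^bsub>K\<^esub> \<one>\<^bsub>K\<^esub>" v] act_closed[of g v] by (simp add: smult_l_minus)

lemma vectorspace_cochains1: "vectorspace K (cochains1 G V)"
proof -
  let ?C = "cochains1 G V"
  have "abelian_group ?C"
  proof (rule abelian_groupI)
    fix f assume f: "f \<in> carrier ?C"
    have "(\<lambda>g\<in>carrier G. \<ominus>\<^bsub>V\<^esub> f g) \<in> carrier ?C" using f by (auto simp: cochains1_def PiE_iff)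
    moreover have "(\<lambda>g\<in>carrier G. \<ominus>\<^bsub>V\<^esub> f g) \<oplus>\<^bsub>?C\<^esub> f = \<zero>\<^bsub>?C\<^esub>"
      using f by (auto simp: cochains1_def PiE_iff M.l_neg intro!: restrict_ext)
    ultimately show "\<exists>h\<in>carrier ?C. h \<oplus>\<^bsub>?C\<^esub> f = \<zero>\<^bsub>?C\<^esub>" by blast
  next
    fix f h k assume "f \<in> carrier ?C" "h \<in> carrier ?C" "k \<in> carrier ?C"
    hence "f g \<in> carrier V" "h g \<in> carrier V" "k g \<in> carrier V" if "g \<in> carrier G" for g
      using that unfolding cochains1_def by auto
    thus "f \<oplus>\<^bsub>?C\<^esub> h \<oplus>\<^bsub>?C\<^esub> k = f \<oplus>\<^bsub>?C\<^esub> (h \<oplus>\<^bsub>?C\<^esub> k)" "f \<oplus>\<^bsub>?C\<^esub> h = h \<oplus>\<^bsub>?C\<^esub> f"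
      unfolding cochains1_def by (simp_all add: M.add.m_ac cong: restrict_cong)
  next
    fix f assume f: "f \<in> carrier ?C"
    have fc: "f g \<in> carrier V" if "g \<in> carrier G" for g using f that unfolding cochains1_def by auto
    \<comment> \<open>Cochains are extensional functions, so the identity is proved between
      restrictions, and f is recovered as its own restriction.\<close>
    have "(\<lambda>g\<in>carrier G. \<zero>\<^bsub>V\<^esub> \<oplus>\<^bsub>V\<^esub> f g) = (\<lambda>g\<in>carrier G. f g)"
      by (intro restrict_ext M.l_zero fc)
    thus "\<zero>\<^bsub>?C\<^esub> \<oplus>\<^bsub>?C\<^esub> f = f"
      using f unfolding cochains1_def by (simp add: PiE_restrict cong: restrict_cong)
  qed (auto simp: cochains1_def)
  hence "module K ?C"
  proof (intro moduleI R.cring_axioms)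
    fix f assume f: "f \<in> carrier ?C"
    have fc: "f g \<in> carrier V" if "g \<in> carrier G" for g using f that unfolding cochains1_def by auto
    have "(\<lambda>g\<in>carrier G. \<one>\<^bsub>K\<^esub> \<odot>\<^bsub>V\<^esub> f g) = (\<lambda>g\<in>carrier G. f g)"
      by (intro restrict_ext smult_one fc)
    thus "\<one>\<^bsub>K\<^esub> \<odot>\<^bsub>?C\<^esub> f = f" using f unfolding cochains1_def by (simp add: PiE_restrict)
  next
    fix a b f assume "a \<in> carrier K" "b \<in> carrier K" "f \<in> carrier ?C"
    moreover from this have "f g \<in> carrier V" if "g \<in> carrier G" for g
      using that unfolding cochains1_def by auto
    ultimately show "(a \<oplus>\<^bsub>K\<^esub> b) \<odot>\<^bsub>?C\<^esub> f = a \<odot>\<^bsub>?C\<^esub> f \<oplus>\<^bsub>?C\<^esub> b \<odot>\<^bsub>?C\<^esub> f"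
        "(a \<otimes>\<^bsub>K\<^esub> b) \<odot>\<^bsub>?C\<^esub> f = a \<odot>\<^bsub>?C\<^esub> (b \<odot>\<^bsub>?C\<^esub> f)"
      unfolding cochains1_def by (simp_all add: smult_l_distr smult_assoc1 cong: restrict_cong)
  next
    fix a f h assume "a \<in> carrier K" "f \<in> carrier ?C" "h \<in> carrier ?C"
    moreover from this have "f g \<in> carrier V" "h g \<in> carrier V" if "g \<in> carrier G" for g
      using that unfolding cochains1_def by auto
    ultimately show "a \<odot>\<^bsub>?C\<^esub> (f \<oplus>\<^bsub>?C\<^esub> h) = a \<odot>\<^bsub>?C\<^esub> f \<oplus>\<^bsub>?C\<^esub> a \<odot>\<^bsub>?C\<^esub> h"
      unfolding cochains1_def by (simp add: smult_r_distr cong: restrict_cong)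
  qed (auto simp: cochains1_def)
  thus ?thesis by (intro vectorspace.intro field_axioms)
qed

lemma submodule_cocycles1: "LinearCombinations.submodule K (cocycles1 G V act) (cochains1 G V)"
proof (rule LinearCombinations.submodule.intro)
  show "module K (cochains1 G V)" using vectorspace_cochains1 by (rule vectorspace.axioms)
  show "cocycles1 G V act \<subseteq> carrier (cochains1 G V)"
    unfolding cochains1_def cocycles1_def by simp
  show "\<zero>\<^bsub>cochains1 G V\<^esub> \<in> cocycles1 G V act"
    unfolding cochains1_def cocycles1_def by (simp add: G_closed act_zero)
next
  fix f f' assume f: "f \<in> cocycles1 G V act" and f': "f' \<in> cocycles1 G V act"
  have c: "f g \<in> carrier V" "f' g \<in> carrier V" if "g \<in> carrier G" for g
    using f f' that unfolding cocycles1_def by auto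
  have "f (g \<otimes>\<^bsub>G\<^esub> h) \<oplus>\<^bsub>V\<^esub> f' (g \<otimes>\<^bsub>G\<^esub> h) = f g \<oplus>\<^bsub>V\<^esub> f' g \<oplus>\<^bsub>V\<^esub> act g (f h \<oplus>\<^bsub>V\<^esub> f' h)"
    if gh: "g \<in> carrier G" "h \<in> carrier G" for g h
  proof -
    have "f (g \<otimes>\<^bsub>G\<^esub> h) = f g \<oplus>\<^bsub>V\<^esub> act g (f h)" "f' (g \<otimes>\<^bsub>G\<^esub> h) = f' g \<oplus>\<^bsub>V\<^esub> act g (f' h)"
      using f f' gh unfolding cocycles1_def by blast+
    thus ?thesis
      using c[OF gh(1)] c[OF gh(2)] act_closed[OF gh(1) c(1)[OF gh(2)]] act_closed[OF gh(1) c(2)[OF gh(2)]] gh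
      by (simp add: act_add M.add.m_ac)
  qed
  thus "f \<oplus>\<^bsub>cochains1 G V\<^esub> f' \<in> cocycles1 G V act"
    using c unfolding cochains1_def cocycles1_def by (simp add: G_closed)
next
  fix k f assume k: "k \<in> carrier K" and f: "f \<in> cocycles1 G V act"
  have c: "f g \<in> carrier V" if "g \<in> carrier G" for g
    using f that unfolding cocycles1_def by auto
  have "k \<odot>\<^bsub>V\<^esub> f (g \<otimes>\<^bsub>G\<^esub> h) = k \<odot>\<^bsub>V\<^esub> f g \<oplus>\<^bsub>V\<^esub> act g (k \<odot>\<^bsub>V\<^esub> f h)"
    if gh: "g \<in> carrier G" "h \<in> carrier G" for g h
  proof -
    have "f (g \<otimes>\<^bsub>G\<^esub> h) = f g \<oplus>\<^bsub>V\<^esub> act g (f h)" using f gh unfolding cocycles1_def by blast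
    thus ?thesis using c[OF gh(1)] c[OF gh(2)] act_closed[OF gh(1) c[OF gh(2)]] gh k
      by (simp add: act_smult smult_r_distr)
  qed
  thus "k \<odot>\<^bsub>cochains1 G V\<^esub> f \<in> cocycles1 G V act"
    using c k unfolding cochains1_def cocycles1_def by (simp add: G_closed)
qed

text \<open>Restricting the carrier while keeping the operations makes \<open>group_H1\<close>
  literally the quotient of this space by the coboundaries.\<close>

definition cocycle_space :: "('k, 'g \<Rightarrow> 'v) module" where
  "cocycle_space = (cochains1 G V)\<lparr>carrier := cocycles1 G V act\<rparr>"

lemma vectorspace_cocycle_space: "vectorspace K cocycle_space"
proof -
  have "subspace K (cocycles1 G V act) (cochains1 G V)"
    by (rule subspace.intro[OF vectorspace_cochains1 submodule_cocycles1])
  from vectorspace.subspace_is_vs[OF vectorspace_cochains1 this]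
  show ?thesis unfolding cocycle_space_def .
qed

text \<open>Telescoping: gh v - v = (g v - v) + g (h v - v).\<close>

lemma coboundary_cocycle:
  assumes v: "v \<in> carrier V"
  shows "(\<lambda>g\<in>carrier G. act g v \<ominus>\<^bsub>V\<^esub> v) \<in> cocycles1 G V act"
proof -
  have "act (g \<otimes>\<^bsub>G\<^esub> h) v \<ominus>\<^bsub>V\<^esub> v = act g v \<ominus>\<^bsub>V\<^esub> v \<oplus>\<^bsub>V\<^esub> act g (act h v \<ominus>\<^bsub>V\<^esub> v)"
    if gh: "g \<in> carrier G" "h \<in> carrier G" for g h
  proof -
    note c = act_closed[OF gh(1) v] act_closed[OF gh(2) v] act_closed[OF gh(1) act_closed[OF gh(2) v]] v
    have "act g (act h v \<ominus>\<^bsub>V\<^esub> v) = act g (act h v) \<oplus>\<^bsub>V\<^esub> \<ominus>\<^bsub>V\<^esub> act g v"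
      using gh c by (simp add: a_minus_def act_add act_minus)
    moreover have "(act g v \<oplus>\<^bsub>V\<^esub> \<ominus>\<^bsub>V\<^esub> v) \<oplus>\<^bsub>V\<^esub> (act g (act h v) \<oplus>\<^bsub>V\<^esub> \<ominus>\<^bsub>V\<^esub> act g v)
        = (act g v \<oplus>\<^bsub>V\<^esub> \<ominus>\<^bsub>V\<^esub> act g v) \<oplus>\<^bsub>V\<^esub> (act g (act h v) \<oplus>\<^bsub>V\<^esub> \<ominus>\<^bsub>V\<^esub> v)"
      using c by (simp add: M.add.m_ac)
    ultimately show ?thesis using gh c by (simp add: act_mult M.minus_eq M.r_neg)
  qed
  thus ?thesis using v by (auto simp: cocycles1_def G_closed act_closed)
qed

lemma submodule_coboundaries1:
  "LinearCombinations.submodule K (coboundaries1 G V act) cocycle_space"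
proof (rule LinearCombinations.submodule.intro)
  show "module K cocycle_space" using vectorspace_cocycle_space by (rule vectorspace.axioms)
  show "coboundaries1 G V act \<subseteq> carrier cocycle_space"
    using coboundary_cocycle by (auto simp: coboundaries1_def cocycle_space_def)
  show "\<zero>\<^bsub>cocycle_space\<^esub> \<in> coboundaries1 G V act"
  proof -
    have z: "\<zero>\<^bsub>V\<^esub> \<ominus>\<^bsub>V\<^esub> \<zero>\<^bsub>V\<^esub> = \<zero>\<^bsub>V\<^esub>" unfolding M.minus_eq by (rule M.r_neg) simp
    have "\<zero>\<^bsub>cocycle_space\<^esub> = (\<lambda>g\<in>carrier G. act g \<zero>\<^bsub>V\<^esub> \<ominus>\<^bsub>V\<^esub> \<zero>\<^bsub>V\<^esub>)"
      unfolding cocycle_space_def cochains1_def by (simp add: act_zero z cong: restrict_cong)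
    thus ?thesis unfolding coboundaries1_def by blast
  qed
next
  fix x y assume "x \<in> coboundaries1 G V act" "y \<in> coboundaries1 G V act"
  then obtain v w where x: "x = (\<lambda>g\<in>carrier G. act g v \<ominus>\<^bsub>V\<^esub> v)" "v \<in> carrier V"
    and y: "y = (\<lambda>g\<in>carrier G. act g w \<ominus>\<^bsub>V\<^esub> w)" "w \<in> carrier V" by (auto simp: coboundaries1_def)
  have "x \<oplus>\<^bsub>cocycle_space\<^esub> y = (\<lambda>g\<in>carrier G. act g (v \<oplus>\<^bsub>V\<^esub> w) \<ominus>\<^bsub>V\<^esub> (v \<oplus>\<^bsub>V\<^esub> w))"
    using x y by (auto simp: cocycle_space_def cochains1_def act_add act_closed a_minus_def
        M.minus_add M.add.m_ac intro!: restrict_ext)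
  thus "x \<oplus>\<^bsub>cocycle_space\<^esub> y \<in> coboundaries1 G V act"
    using x y unfolding coboundaries1_def by blast
next
  fix c x assume c: "c \<in> carrier K" and "x \<in> coboundaries1 G V act"
  then obtain v where x: "x = (\<lambda>g\<in>carrier G. act g v \<ominus>\<^bsub>V\<^esub> v)" "v \<in> carrier V"
    by (auto simp: coboundaries1_def)
  have "c \<odot>\<^bsub>cocycle_space\<^esub> x = (\<lambda>g\<in>carrier G. act g (c \<odot>\<^bsub>V\<^esub> v) \<ominus>\<^bsub>V\<^esub> (c \<odot>\<^bsub>V\<^esub> v))"
    using x c by (auto simp: cocycle_space_def cochains1_def act_smult act_closed a_minus_def
        smult_r_distr smult_r_minus intro!: restrict_ext)
  thus "c \<odot>\<^bsub>cocycle_space\<^esub> x \<in> coboundaries1 G V act"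
    using x c unfolding coboundaries1_def by blast
qed

text \<open>Turns the dimension into a pointwise statement on the carrier; extensionality upgrades
  pointwise agreement to equality of cochains.\<close>

lemma has_dim_group_H1_0:
  assumes "\<And>f. f \<in> cocycles1 G V act \<Longrightarrow> \<exists>v\<in>carrier V. \<forall>g\<in>carrier G. f g = act g v \<ominus>\<^bsub>V\<^esub> v"
  shows "has_dim K (group_H1 G V act) 0"
proof -
  have "cocycles1 G V act \<subseteq> coboundaries1 G V act"
  proof
    fix f assume f: "f \<in> cocycles1 G V act"
    then obtain v where v: "v \<in> carrier V" "\<forall>g\<in>carrier G. f g = act g v \<ominus>\<^bsub>V\<^esub> v" using assms by blast
    have "f = (\<lambda>g\<in>carrier G. act g v \<ominus>\<^bsub>V\<^esub> v)"
      using f v by (intro extensionalityI[where A="carrier G"]) (simp_all add: cocycles1_def PiE_iff)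
    thus "f \<in> coboundaries1 G V act" using v unfolding coboundaries1_def by blast
  qed
  hence "coboundaries1 G V act = carrier cocycle_space"
    using coboundary_cocycle by (auto simp: coboundaries1_def cocycle_space_def)
  from has_dim_quot_module_0[OF vectorspace_cocycle_space submodule_coboundaries1 this]
  show ?thesis unfolding group_H1_def cocycle_space_def .
qed

lemma has_dim_group_H1_1:
  assumes z: "z \<in> cocycles1 G V act"
    and z_nontriv: "\<And>v. v \<in> carrier V \<Longrightarrow> \<exists>g\<in>carrier G. z g \<noteq> act g v \<ominus>\<^bsub>V\<^esub> v"
    and gen: "\<And>f. f \<in> cocycles1 G V act \<Longrightarrow>
      \<exists>c\<in>carrier K. \<exists>v\<in>carrier V. \<forall>g\<in>carrier G. f g = (act g v \<ominus>\<^bsub>V\<^esub> v) \<oplus>\<^bsub>V\<^esub> c \<odot>\<^bsub>V\<^esub> z g"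
  shows "has_dim K (group_H1 G V act) 1"
proof -
  have "z \<notin> coboundaries1 G V act" using z_nontriv by (force simp: coboundaries1_def)
  moreover have "\<exists>c\<in>carrier K. \<exists>n\<in>coboundaries1 G V act. f = n \<oplus>\<^bsub>cocycle_space\<^esub> c \<odot>\<^bsub>cocycle_space\<^esub> z"
    if f: "f \<in> carrier cocycle_space" for f
  proof -
    have f: "f \<in> cocycles1 G V act" using f by (simp add: cocycle_space_def)
    obtain c v where c: "c \<in> carrier K" and v: "v \<in> carrier V"
      and fg: "\<And>g. g \<in> carrier G \<Longrightarrow> f g = (act g v \<ominus>\<^bsub>V\<^esub> v) \<oplus>\<^bsub>V\<^esub> c \<odot>\<^bsub>V\<^esub> z g" using gen[OF f] by blast
    have "f = (\<lambda>g\<in>carrier G. act g v \<ominus>\<^bsub>V\<^esub> v) \<oplus>\<^bsub>cocycle_space\<^esub> c \<odot>\<^bsub>cocycle_space\<^esub> z"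
    proof (rule extensionalityI[where A="carrier G"])
      show "f \<in> extensional (carrier G)" using f by (simp add: cocycles1_def PiE_iff)
    qed (simp_all add: fg cocycle_space_def cochains1_def)
    moreover have "(\<lambda>g\<in>carrier G. act g v \<ominus>\<^bsub>V\<^esub> v) \<in> coboundaries1 G V act"
      using v unfolding coboundaries1_def by blast
    ultimately show ?thesis using c by blast
  qed
  ultimately show ?thesis
    using has_dim_quot_module_1[OF vectorspace_cocycle_space submodule_coboundaries1, of z] z
    unfolding group_H1_def by (simp add: cocycle_space_def)
qed

end

section \<open>Symmetric powers of lower triangular matrices\<close>

text \<open>Past the degree both sides are 0, so the formula can be used under sums whose index
  exceeds n.\<close>

lemma coeff_linear_power_binomial:
  fixes a b :: "'a :: comm_semiring_1"
  shows "coeff ([:a, b:] ^ n) i = of_nat (n choose i) * b ^ i * a ^ (n - i)"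
proof (cases "i \<le> n")
  case False
  have "degree ([:a, b:] ^ n) \<le> degree [:a, b:] * n" by (rule degree_power_le)
  also have "\<dots> \<le> 1 * n" by (intro mult_right_mono) auto
  finally show ?thesis using False by (simp add: coeff_eq_0 binomial_eq_0)
qed (simp add: coeff_linear_poly_power)

lemma lower_mat_index [simp]:
  "lower_mat t u $$ (0, 0) = t" "lower_mat t u $$ (0, 1) = 0" "lower_mat t u $$ (0, Suc 0) = 0"
  "lower_mat t u $$ (1, 0) = u" "lower_mat t u $$ (1, 1) = inverse t"
  "lower_mat t u $$ (Suc 0, 0) = u" "lower_mat t u $$ (Suc 0, Suc 0) = inverse t"
  by (simp_all add: lower_mat_def mat_of_rows_list_def)

lemma lower_mat_dim [simp]:
  "lower_mat t u \<in> carrier_mat 2 2" "dim_row (lower_mat t u) = 2" "dim_col (lower_mat t u) = 2"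
  by (auto simp: lower_mat_def mat_of_rows_list_def)

lemma mat_2_eqI:
  assumes "A \<in> carrier_mat 2 2" "B \<in> carrier_mat 2 2"
    and "A $$ (0, 0) = B $$ (0, 0)" "A $$ (0, 1) = B $$ (0, 1)"
    and "A $$ (1, 0) = B $$ (1, 0)" "A $$ (1, 1) = B $$ (1, 1)"
  shows "A = B"
  using assms by (intro eq_matI) (auto simp: less_2_cases_iff)

lemma lower_mat_mult:
  "lower_mat t u * lower_mat s v = lower_mat (t * s) (u * s + inverse t * v)"
  by (rule mat_2_eqI) (auto simp: scalar_prod_def numeral_2_eq_2)

lemma lower_mat_uminus: "- lower_mat t u = lower_mat (- t) (- u)"
  by (rule mat_2_eqI) auto

text \<open>Real parameters serve both tensor factors: the second one is the same kind of matrix at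
  \<open>cj t\<close> and \<open>cj u\<close>.\<close>

definition sym_lower :: "nat \<Rightarrow> real \<Rightarrow> real \<Rightarrow> complex mat" where
  "sym_lower l t u = sym_rep l (map_mat complex_of_real (lower_mat t u))"

lemma sym_lower_carrier [simp]: "sym_lower l t u \<in> carrier_mat (Suc l) (Suc l)"
  unfolding sym_lower_def sym_rep_def by simp

lemma sym_lower_dim [simp]: "dim_row (sym_lower l t u) = Suc l" "dim_col (sym_lower l t u) = Suc l"
  unfolding sym_lower_def sym_rep_def by simp_all

text \<open>The first row of the matrix contributes only the constant t, so all powers of y come
  from (u + y / t)^i; entries above the diagonal vanish with the binomial coefficient.\<close>

lemma sym_lower_index:
  assumes "i \<le> l" "j \<le> l"
  shows "sym_lower l t u $$ (i, j) =
    of_real (t ^ (l - i) * (real (i choose j) * inverse t ^ j * u ^ (i - j)))"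
proof -
  have "[:complex_of_real t, 0:] ^ (l - i) = [:complex_of_real t ^ (l - i):]"
    by (simp add: pCons_0_0 poly_const_pow)
  thus ?thesis using assms
    unfolding sym_lower_def sym_rep_def by (simp add: coeff_linear_power_binomial)
qed

text \<open>P is the generating polynomial of row i of the product, and \<open>a j\<close> are the
  entries of row i of the first factor. The binomial theorem sums P to a power of the composed
  linear form, which is row i of the right-hand side.\<close>

lemma sym_lower_mult:
  assumes t: "t \<noteq> 0" and s: "s \<noteq> 0"
  shows "sym_lower l t u * sym_lower l s v = sym_lower l (t * s) (u * s + inverse t * v)"
proof (rule eq_matI)
  fix i k assume "i < dim_row (sym_lower l (t * s) (u * s + inverse t * v))"
    "k < dim_col (sym_lower l (t * s) (u * s + inverse t * v))"
  hence i: "i \<le> l" and k: "k \<le> l" by simp_all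
  define a where "a j = t ^ (l - i) * (real (i choose j) * inverse t ^ j * u ^ (i - j))" for j
  define P where "P = (\<Sum>j\<le>l. Polynomial.smult (a j * s ^ (l - j)) ([:v, inverse s:] ^ j))"
  have "P = (\<Sum>j\<le>i. Polynomial.smult (a j * s ^ (l - j)) ([:v, inverse s:] ^ j))"
    unfolding P_def using i by (intro sum.mono_neutral_right) (auto simp: a_def)
  also have "\<dots> = (\<Sum>j\<le>i. Polynomial.smult ((t * s) ^ (l - i))
      (of_nat (i choose j) * [:inverse t * v, inverse (t * s):] ^ j * [:u * s:] ^ (i - j)))"
  proof (rule sum.cong[OF refl])
    fix j assume "j \<in> {..i}"
    \<comment> \<open>For j <= i the power s^(l - j) splits into the common factor s^(l - i) and the
      part absorbed by (u s)^(i - j).\<close>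
    hence j: "l - j = (l - i) + (i - j)" using i by simp
    have "[:inverse t * v, inverse (t * s):] = Polynomial.smult (inverse t) [:v, inverse s:]"
      by simp
    hence e: "[:inverse t * v, inverse (t * s):] ^ j = Polynomial.smult (inverse t ^ j) ([:v, inverse s:] ^ j)"
      by (simp only: smult_power)
    show "Polynomial.smult (a j * s ^ (l - j)) ([:v, inverse s:] ^ j) = Polynomial.smult ((t * s) ^ (l - i))
      (of_nat (i choose j) * [:inverse t * v, inverse (t * s):] ^ j * [:u * s:] ^ (i - j))"
      unfolding a_def j e
      by (simp add: poly_const_pow power_add power_mult_distrib of_nat_poly mult_ac)
  qed
  also have "\<dots> = Polynomial.smult ((t * s) ^ (l - i)) (([:inverse t * v, inverse (t * s):] + [:u * s:]) ^ i)"
    unfolding binomial_ring by (rule poly_eqI) (simp add: coeff_sum sum_distrib_left)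
  also have "[:inverse t * v, inverse (t * s):] + [:u * s:] = [:u * s + inverse t * v, inverse (t * s):]"
    by simp
  finally have P: "P = Polynomial.smult ((t * s) ^ (l - i)) ([:u * s + inverse t * v, inverse (t * s):] ^ i)" .
  have "(sym_lower l t u * sym_lower l s v) $$ (i, k) = (\<Sum>j<Suc l. sym_lower l t u $$ (i, j) * sym_lower l s v $$ (j, k))"
    using i k by (simp add: scalar_prod_def atLeast0LessThan)
  also have "\<dots> = of_real (\<Sum>j\<le>l. a j * (s ^ (l - j) * coeff ([:v, inverse s:] ^ j) k))"
    unfolding lessThan_Suc_atMost of_real_sum
    using i k by (intro sum.cong) (auto simp: sym_lower_index a_def coeff_linear_power_binomial)
  also have "(\<Sum>j\<le>l. a j * (s ^ (l - j) * coeff ([:v, inverse s:] ^ j) k)) = coeff P k"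
    unfolding P_def by (simp add: coeff_sum mult_ac)
  also have "complex_of_real (coeff P k) = sym_lower l (t * s) (u * s + inverse t * v) $$ (i, k)"
    unfolding P using i k by (simp add: sym_lower_index coeff_linear_power_binomial)
  finally show "(sym_lower l t u * sym_lower l s v) $$ (i, k) = sym_lower l (t * s) (u * s + inverse t * v) $$ (i, k)" .
qed simp_all

text \<open>On and below the diagonal an entry is a multiple of a monomial with (l - i) + j + (i -
  j) = l factors among t, 1/t and u, and every factor changes sign. This sign decides whether the
  action descends to the quotient by signs.\<close>

lemma sym_lower_uminus: "sym_lower l (- t) (- u) = (-1) ^ l \<cdot>\<^sub>m sym_lower l t u"
proof (rule eq_matI)
  fix i j assume "i < dim_row ((-1) ^ l \<cdot>\<^sub>m sym_lower l t u)" "j < dim_col ((-1) ^ l \<cdot>\<^sub>m sym_lower l t u)"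
  hence i: "i \<le> l" and j: "j \<le> l" by simp_all
  show "sym_lower l (- t) (- u) $$ (i, j) = ((-1) ^ l \<cdot>\<^sub>m sym_lower l t u) $$ (i, j)"
  proof (cases "j \<le> i")
    case True
    have l: "l = (l - i) + (j + (i - j))" using i True by simp
    have "(- t) ^ (l - i) * (real (i choose j) * inverse (- t) ^ j * (- u) ^ (i - j)) =
      (-1) ^ l * (t ^ (l - i) * (real (i choose j) * inverse t ^ j * u ^ (i - j)))"
      by (subst (2) l) (simp add: power_add power_minus[of t] power_minus[of u] power_minus[of "inverse t"] mult_ac)
    hence "sym_lower l (- t) (- u) $$ (i, j) =
      of_real ((-1) ^ l * (t ^ (l - i) * (real (i choose j) * inverse t ^ j * u ^ (i - j))))"
      unfolding sym_lower_index[OF i j] by (rule arg_cong)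
    also have "\<dots> = ((-1) ^ l \<cdot>\<^sub>m sym_lower l t u) $$ (i, j)"
      using i j by (simp add: sym_lower_index)
    finally show ?thesis .
  qed (use i j in \<open>simp add: sym_lower_index\<close>)
qed simp_all

section \<open>Tensor products acting on matrices\<close>

lemma tensor_op_index:
  assumes "A \<in> carrier_mat m m" "B \<in> carrier_mat n n" "X \<in> carrier_mat m n" "i < m" "j < n"
  shows "tensor_op A B X $$ (i, j) = (\<Sum>k<m. \<Sum>q<n. A $$ (i, k) * X $$ (k, q) * B $$ (j, q))"
proof -
  have "tensor_op A B X $$ (i, j) = (\<Sum>k<m. A $$ (i, k) * (\<Sum>q<n. X $$ (k, q) * B $$ (j, q)))"
    using assms by (simp add: tensor_op_def scalar_prod_def atLeast0LessThan)
  thus ?thesis by (simp add: sum_distrib_left mult.assoc)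
qed

lemma tensor_op_dim [simp]:
  "dim_row (tensor_op A B X) = dim_row A" "dim_col (tensor_op A B X) = dim_row B"
  unfolding tensor_op_def by simp_all

lemma tensor_op_smult:
  assumes "A \<in> carrier_mat m m" "B \<in> carrier_mat n n" "X \<in> carrier_mat m n"
  shows "tensor_op (a \<cdot>\<^sub>m A) (b \<cdot>\<^sub>m B) X = (a * b) \<cdot>\<^sub>m tensor_op A B X"
proof (rule eq_matI)
  fix i j assume "i < dim_row ((a * b) \<cdot>\<^sub>m tensor_op A B X)" "j < dim_col ((a * b) \<cdot>\<^sub>m tensor_op A B X)"
  hence i: "i < m" and j: "j < n" using assms by auto
  show "tensor_op (a \<cdot>\<^sub>m A) (b \<cdot>\<^sub>m B) X $$ (i, j) = ((a * b) \<cdot>\<^sub>m tensor_op A B X) $$ (i, j)"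
    using tensor_op_index[OF smult_carrier_mat[OF assms(1)] smult_carrier_mat[OF assms(2)] assms(3) i j, of a b]
      tensor_op_index[OF assms i j] assms i j
    by (simp add: sum_distrib_left mult_ac)
qed simp_all

lemma sum_single:
  fixes f :: "nat \<Rightarrow> 'a :: comm_monoid_add"
  assumes "j < n" "\<And>q. q < n \<Longrightarrow> q \<noteq> j \<Longrightarrow> f q = 0"
  shows "(\<Sum>q<n. f q) = f j"
proof -
  have "(\<Sum>q<n. f q) = (\<Sum>q<n. if q = j then f j else 0)"
    using assms by (intro sum.cong) auto
  thus ?thesis using assms(1) by simp
qed

lemma sym_lower_unipotent_index:
  "i \<le> l \<Longrightarrow> k \<le> l \<Longrightarrow> sym_lower l 1 u $$ (i, k) = of_nat (i choose k) * of_real u ^ (i - k)"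
  by (simp add: sym_lower_index)

lemma sym_lower_diag_index:
  "i \<le> l \<Longrightarrow> k \<le> l \<Longrightarrow>
    sym_lower l t 0 $$ (i, k) = (if i = k then of_real (t ^ (l - i) * inverse t ^ i) else 0)"
  by (cases "k < i") (auto simp: sym_lower_index)

lemma power_int_inj_gt_1:
  fixes x :: real
  assumes "x > 1" "x powi a = x powi b"
  shows "a = b"
  using power_int_strict_increasing[of a b x] power_int_strict_increasing[of b a x] assms
  by (cases a b rule: linorder_cases) auto

lemma tensor_op_compose:
  assumes "A \<in> carrier_mat m m" "A' \<in> carrier_mat m m" "B \<in> carrier_mat n n" "B' \<in> carrier_mat n n"
    "X \<in> carrier_mat m n"
  shows "tensor_op (A * A') (B * B') X = tensor_op A B (tensor_op A' B' X)"
proof -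
  have "tensor_op (A * A') (B * B') X = A * A' * X * (transpose_mat B' * transpose_mat B)"
    unfolding tensor_op_def using transpose_mult[OF assms(3,4)] by simp
  also have "\<dots> = A * (A' * X) * (transpose_mat B' * transpose_mat B)"
    using assoc_mult_mat[OF assms(1,2,5)] by simp
  also have "\<dots> = A * (A' * X) * transpose_mat B' * transpose_mat B"
    using assms by (intro assoc_mult_mat[symmetric]) auto
  also have "A * (A' * X) * transpose_mat B' = A * (A' * X * transpose_mat B')"
    using assms by (intro assoc_mult_mat) auto
  finally show ?thesis unfolding tensor_op_def .
qed

lemma tensor_op_closed:
  "A \<in> carrier_mat m m \<Longrightarrow> B \<in> carrier_mat n n \<Longrightarrow> tensor_op A B X \<in> carrier_mat m n"
  by (intro carrier_matI) auto

lemma tensor_op_add: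
  assumes "A \<in> carrier_mat m m" "B \<in> carrier_mat n n" "X \<in> carrier_mat m n" "Y \<in> carrier_mat m n"
  shows "tensor_op A B (X + Y) = tensor_op A B X + tensor_op A B Y"
proof -
  have "tensor_op A B (X + Y) = (A * X + A * Y) * transpose_mat B"
    unfolding tensor_op_def using mult_add_distrib_mat[OF assms(1,3,4)] by simp
  also have "\<dots> = A * X * transpose_mat B + A * Y * transpose_mat B"
    using assms by (intro add_mult_distrib_mat) auto
  finally show ?thesis unfolding tensor_op_def .
qed

lemma tensor_op_scale:
  assumes "A \<in> carrier_mat m m" "B \<in> carrier_mat n n" "X \<in> carrier_mat m n"
  shows "tensor_op A B (c \<cdot>\<^sub>m X) = c \<cdot>\<^sub>m tensor_op A B X"
  unfolding tensor_op_def
  using mult_smult_distrib[OF assms(1,3)] mult_smult_assoc_mat[of "A * X" m n "transpose_mat B" n c] assms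
  by auto

lemma mat_eq_if_minus_zero:
  fixes A B :: "'a :: group_add mat"
  assumes "A \<in> carrier_mat r c" "B \<in> carrier_mat r c" "A - B = 0\<^sub>m r c"
  shows "A = B"
proof (rule eq_matI)
  fix i j assume ij: "i < dim_row B" "j < dim_col B"
  have "(A - B) $$ (i, j) = 0" unfolding assms(3) using ij assms(2) by simp
  thus "A $$ (i, j) = B $$ (i, j)" using ij by simp
qed (use assms in auto)

section \<open>The parabolic subgroup and its action\<close>

context real_quadratic
begin

lemma quad_unitsD:
  assumes "t \<in> quad_units d"
  shows "t \<in> \<O>" "inverse t \<in> \<O>" "t \<noteq> 0" "inverse t \<in> quad_units d" "cj t \<noteq> 0" "cj (inverse t) = inverse (cj t)"
proof -
  from assms obtain s where ts: "t \<in> \<O>" "s \<in> \<O>" "t * s = 1" unfolding quad_units_def by blast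
  have "t \<noteq> 0" using ts by auto
  moreover from this have s: "s = inverse t" using ts by (simp add: field_simps)
  moreover have c: "cj t * cj s = 1" using quad_conj_mult[OF ts(1,2)] ts(3) by simp
  moreover have "cj t \<noteq> 0" using c by auto
  ultimately show "t \<in> \<O>" "inverse t \<in> \<O>" "t \<noteq> 0" "inverse t \<in> quad_units d" "cj t \<noteq> 0"
    "cj (inverse t) = inverse (cj t)"
    using ts unfolding s[symmetric] by (auto simp: quad_units_def mult.commute inverse_unique)
qed

lemma quad_units_mult:
  assumes "t \<in> quad_units d" "s \<in> quad_units d"
  shows "t * s \<in> quad_units d"
proof -
  have "(t * s) * (inverse s * inverse t) = 1" using quad_unitsD(3) assms by (simp add: field_simps)
  moreover have "t * s \<in> \<O>" "inverse s * inverse t \<in> \<O>"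
    using quad_unitsD(1,2)[OF assms(1)] quad_unitsD(1,2)[OF assms(2)] by (auto intro: quad_ints_mult)
  ultimately show ?thesis unfolding quad_units_def by blast
qed

lemma quad_units_1: "1 \<in> quad_units d"
  unfolding quad_units_def by auto

text \<open>The coset of \<open>lower_mat t u\<close> written out as a pair; the parameters (t, u)
  are determined only up to a common sign.\<close>

definition par_elem :: "real \<Rightarrow> real \<Rightarrow> real mat set" where
  "par_elem t u = {lower_mat t u, - lower_mat t u}"

lemma par_elem_uminus: "par_elem (- t) (- u) = par_elem t u"
  unfolding par_elem_def lower_mat_uminus[symmetric] by auto

lemma parabolic_carrier:
  "carrier (parabolic d) = {par_elem t u | t u. t \<in> quad_units d \<and> u \<in> \<O>}"
proof -
  have "{1\<^sub>m 2, - 1\<^sub>m 2} #>\<^bsub>SL2 d\<^esub> A = {A, - A}" if "A \<in> carrier_mat 2 2" for A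
    using that by (auto simp: r_coset_def SL2_def)
  thus ?thesis unfolding parabolic_def par_elem_def by simp
qed

lemma par_elem_mult:
  "par_elem t u \<otimes>\<^bsub>parabolic d\<^esub> par_elem s v = par_elem (t * s) (u * s + inverse t * v)"
  by (auto simp: parabolic_def PSL2_def FactGroup_def set_mult_def SL2_def par_elem_def
      lower_mat_mult[symmetric])

lemma par_elem_closed: "t \<in> quad_units d \<Longrightarrow> u \<in> \<O> \<Longrightarrow> par_elem t u \<in> carrier (parabolic d)"
  unfolding parabolic_carrier by blast

lemma par_elemE:
  assumes "g \<in> carrier (parabolic d)"
  obtains t u where "t \<in> quad_units d" "u \<in> \<O>" "g = par_elem t u"
  using assms unfolding parabolic_carrier by blast

lemma parabolic_closed:
  assumes "g \<in> carrier (parabolic d)" "h \<in> carrier (parabolic d)"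
  shows "g \<otimes>\<^bsub>parabolic d\<^esub> h \<in> carrier (parabolic d)"
proof -
  obtain t u where g: "t \<in> quad_units d" "u \<in> \<O>" "g = par_elem t u" using assms(1) by (rule par_elemE)
  obtain s v where h: "s \<in> quad_units d" "v \<in> \<O>" "h = par_elem s v" using assms(2) by (rule par_elemE)
  show ?thesis unfolding g h par_elem_mult
    using g h quad_unitsD by (intro par_elem_closed quad_units_mult quad_ints_add quad_ints_mult) auto
qed

text \<open>The two representatives act with relative sign (-1)^(l1 + l2) = 1, so
  \<open>the_elem\<close> is applied to a singleton. The conjugate matrix is again a
  \<open>lower_mat\<close> because conjugation commutes with inversion of units.\<close>

lemma V_act_par_elem:
  assumes t: "t \<in> quad_units d" and u: "u \<in> \<O>" and X: "X \<in> carrier_mat (Suc l1) (Suc l2)"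
    and par: "[l1 = l2] (mod 2)"
  shows "V_act d l1 l2 (par_elem t u) X =
    tensor_op (sym_lower l1 t u) (sym_lower l2 (cj t) (cj u)) X"
proof -
  have cl: "map_mat cj (lower_mat s v) = lower_mat (cj s) (cj v)" if "s \<in> quad_units d" for s v
    by (rule mat_2_eqI) (use quad_unitsD[OF that] in auto)
  have mt: "- t \<in> quad_units d"
    using t quad_ints_minus unfolding quad_units_def by force
  have "even (l1 + l2)" using par by (auto simp: cong_def)
  hence one: "(-1) ^ l1 * (-1) ^ l2 = (1 :: complex)" by (simp flip: power_add)
  have "tensor_op (sym_lower l1 (- t) (- u)) (sym_lower l2 (cj (- t)) (cj (- u))) X =
    ((-1) ^ l1 * (-1) ^ l2) \<cdot>\<^sub>m tensor_op (sym_lower l1 t u) (sym_lower l2 (cj t) (cj u)) X"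
    unfolding quad_conj_minus[OF u] quad_conj_minus[OF quad_unitsD(1)[OF t]] sym_lower_uminus
    by (rule tensor_op_smult[OF sym_lower_carrier sym_lower_carrier X])
  also have "\<dots> = tensor_op (sym_lower l1 t u) (sym_lower l2 (cj t) (cj u)) X" unfolding one by (intro eq_matI) auto
  finally have "tensor_op (sym_lower l1 (- t) (- u)) (sym_lower l2 (cj (- t)) (cj (- u))) X =
    tensor_op (sym_lower l1 t u) (sym_lower l2 (cj t) (cj u)) X" .
  thus ?thesis
    unfolding V_act_def par_elem_def lower_mat_uminus
    using cl[OF t] cl[OF mt] by (simp add: sym_lower_def)
qed

end

section \<open>The action on V and its weights\<close>

locale parabolic_coeffs = real_quadratic +
  fixes \<epsilon> :: real and l1 l2 :: nat
  assumes fund: "is_fundamental_unit d \<epsilon>" and l2_le: "l2 \<le> l1" and l_cong: "[l1 = l2] (mod 2)"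
begin

abbreviation "P \<equiv> parabolic d"
abbreviation "VV \<equiv> tensor_space (Suc l1) (Suc l2)"
abbreviation "CM \<equiv> carrier_mat (Suc l1) (Suc l2) :: complex mat set"
abbreviation "act \<equiv> V_act d l1 l2"
abbreviation "Z1 \<equiv> cocycles1 P VV act"
abbreviation "N u \<equiv> par_elem 1 u"
abbreviation "T \<equiv> par_elem \<epsilon> 0"

lemma eps: "\<epsilon> \<in> quad_units d" "\<epsilon> > 1"
  using fund unfolding is_fundamental_unit_def by auto

lemma VV_simps:
  "carrier VV = CM" "\<zero>\<^bsub>VV\<^esub> = 0\<^sub>m (Suc l1) (Suc l2)" "X \<oplus>\<^bsub>VV\<^esub> Y = X + Y" "c \<odot>\<^bsub>VV\<^esub> X = c \<cdot>\<^sub>m X"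
  unfolding tensor_space_def by (simp_all add: module_mat_simps)

lemma VV_minus:
  assumes "X \<in> CM" "Y \<in> CM"
  shows "X \<ominus>\<^bsub>VV\<^esub> Y = X - Y"
proof -
  interpret abelian_group VV unfolding tensor_space_def by (rule abelian_group_mat)
  have "- Y + Y = 0\<^sub>m (Suc l1) (Suc l2)" using assms by (intro eq_matI) auto
  hence "\<ominus>\<^bsub>VV\<^esub> Y = - Y" using assms by (intro minus_equality) (auto simp: VV_simps)
  thus ?thesis using assms unfolding minus_eq VV_simps by (intro eq_matI) auto
qed

lemma act_par_elem:
  "t \<in> quad_units d \<Longrightarrow> u \<in> \<O> \<Longrightarrow> X \<in> CM \<Longrightarrow>
    act (par_elem t u) X = tensor_op (sym_lower l1 t u) (sym_lower l2 (cj t) (cj u)) X"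
  by (rule V_act_par_elem[OF _ _ _ l_cong])

lemma linear_action: "linear_group_action (class_ring :: complex ring) VV P act"
proof -
  interpret vectorspace "class_ring :: complex ring" VV unfolding tensor_space_def by (rule matrix_vs)
  have closed: "act g X \<in> CM" if "g \<in> carrier P" "X \<in> CM" for g X
    using that(1) by (rule par_elemE) (use that(2) in \<open>simp add: act_par_elem tensor_op_closed\<close>)
  show ?thesis
  proof (unfold_locales, unfold VV_simps)
    fix g h v assume gh: "g \<in> carrier P" "h \<in> carrier P" and v: "v \<in> CM"
    obtain t u where g: "t \<in> quad_units d" "u \<in> \<O>" "g = par_elem t u" using gh(1) by (rule par_elemE)
    obtain s w where h: "s \<in> quad_units d" "w \<in> \<O>" "h = par_elem s w" using gh(2) by (rule par_elemE)
    note t = quad_unitsD[OF g(1)] and s = quad_unitsD[OF h(1)]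
    have "cj (u * s + inverse t * w) = cj u * cj s + inverse (cj t) * cj w"
      using t s g h by (simp add: quad_conj_add quad_conj_mult quad_ints_mult)
    moreover have "cj (t * s) = cj t * cj s" using t s by (simp add: quad_conj_mult)
    moreover have "act h v \<in> CM" by (rule closed[OF gh(2) v])
    moreover have "u * s + inverse t * w \<in> \<O>" using t s g h by (intro quad_ints_add quad_ints_mult)
    ultimately show "act (g \<otimes>\<^bsub>P\<^esub> h) v = act g (act h v)"
      using g h v t s
      by (simp add: par_elem_mult act_par_elem quad_units_mult tensor_op_compose[symmetric] sym_lower_mult
          tensor_op_compose[OF sym_lower_carrier sym_lower_carrier sym_lower_carrier sym_lower_carrier, symmetric])
  next
    fix g v w assume "g \<in> carrier P" "v \<in> CM" "w \<in> CM"
    thus "act g (v + w) = act g v + act g w"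
      by (elim par_elemE) (simp add: act_par_elem tensor_op_add[OF sym_lower_carrier sym_lower_carrier])
  next
    fix g v and c :: complex assume "g \<in> carrier P" "v \<in> CM"
    thus "act g (c \<cdot>\<^sub>m v) = c \<cdot>\<^sub>m act g v"
      by (elim par_elemE) (simp add: act_par_elem tensor_op_scale[OF sym_lower_carrier sym_lower_carrier])
  qed (use parabolic_closed closed in auto)
qed

lemmas act_closed = linear_group_action.act_closed[OF linear_action, unfolded VV_simps]
lemmas act_add = linear_group_action.act_add[OF linear_action, unfolded VV_simps]
lemmas act_zero = linear_group_action.act_zero[OF linear_action, unfolded VV_simps]
lemmas act_smult = linear_group_action.act_smult[OF linear_action, unfolded VV_simps, simplified]

lemma act_diff:
  assumes "g \<in> carrier P" "X \<in> CM" "Y \<in> CM"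
  shows "act g (X - Y) = act g X - act g Y"
proof -
  have d: "X - Y \<in> CM" using assms by (intro minus_carrier_mat)
  have "X = (X - Y) + Y" using assms by (intro eq_matI) auto
  hence "act g X = act g (X - Y) + act g Y" using act_add[OF assms(1) d assms(3)] by (rule ssubst)
  moreover have "act g (X - Y) \<in> CM" "act g Y \<in> CM" using assms d by (auto intro: act_closed)
  ultimately show ?thesis by (intro eq_matI) auto
qed

lemma act_index:
  assumes "t \<in> quad_units d" "u \<in> \<O>" "X \<in> CM" "i \<le> l1" "j \<le> l2"
  shows "act (par_elem t u) X $$ (i, j) = (\<Sum>k<Suc l1. \<Sum>q<Suc l2.
    sym_lower l1 t u $$ (i, k) * X $$ (k, q) * sym_lower l2 (cj t) (cj u) $$ (j, q))"
  using assms by (simp only: act_par_elem) (rule tensor_op_index, auto)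

text \<open>Triangularity of the second factor removes the columns q > j, and the hypothesis removes
  q < j. Only the diagonal entry 1 of that factor survives, so u' disappears from the
  formula.\<close>

lemma act_N_index:
  assumes u: "u \<in> \<O>" and X: "X \<in> CM" and i: "i \<le> l1" and j: "j \<le> l2"
    and zero: "\<And>k q. k \<le> l1 \<Longrightarrow> q < j \<Longrightarrow> X $$ (k, q) = 0"
  shows "act (N u) X $$ (i, j) = (\<Sum>k\<le>i. of_nat (i choose k) * of_real u ^ (i - k) * X $$ (k, j))"
proof -
  have "act (N u) X $$ (i, j) = (\<Sum>k<Suc l1. \<Sum>q<Suc l2.
    sym_lower l1 1 u $$ (i, k) * X $$ (k, q) * sym_lower l2 1 (cj u) $$ (j, q))"
    using act_index[OF quad_units_1 u X i j] by simp
  also have "\<dots> = (\<Sum>k<Suc l1. sym_lower l1 1 u $$ (i, k) * X $$ (k, j) * sym_lower l2 1 (cj u) $$ (j, j))"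
  proof (rule sum.cong[OF refl], rule sum_single)
    fix k q assume k: "k \<in> {..<Suc l1}" and q: "q < Suc l2" "q \<noteq> j"
    show "sym_lower l1 1 u $$ (i, k) * X $$ (k, q) * sym_lower l2 1 (cj u) $$ (j, q) = 0"
      using k q j zero[of k q] by (cases "q < j") (auto simp: sym_lower_unipotent_index)
  qed (use j in auto)
  also have "\<dots> = (\<Sum>k<Suc l1. of_nat (i choose k) * of_real u ^ (i - k) * X $$ (k, j))"
    using i j by (intro sum.cong) (auto simp: sym_lower_unipotent_index)
  also have "\<dots> = (\<Sum>k\<le>i. of_nat (i choose k) * of_real u ^ (i - k) * X $$ (k, j))"
    using i by (intro sum.mono_neutral_right) auto
  finally show ?thesis .
qed

definition weight :: "nat \<Rightarrow> nat \<Rightarrow> real" where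
  "weight i j = (\<epsilon> ^ (l1 - i) * inverse \<epsilon> ^ i) * (cj \<epsilon> ^ (l2 - j) * inverse (cj \<epsilon>) ^ j)"

lemma act_T_index:
  assumes X: "X \<in> CM" and i: "i \<le> l1" and j: "j \<le> l2"
  shows "act T X $$ (i, j) = of_real (weight i j) * X $$ (i, j)"
proof -
  have "act T X $$ (i, j) = (\<Sum>k<Suc l1. \<Sum>q<Suc l2.
    sym_lower l1 \<epsilon> 0 $$ (i, k) * X $$ (k, q) * sym_lower l2 (cj \<epsilon>) 0 $$ (j, q))"
    using act_index[OF eps(1) quad_ints_0 X i j] by simp
  also have "\<dots> = (\<Sum>k<Suc l1. sym_lower l1 \<epsilon> 0 $$ (i, k) * X $$ (k, j) * sym_lower l2 (cj \<epsilon>) 0 $$ (j, j))"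
    using j by (intro sum.cong[OF refl] sum_single) (auto simp: sym_lower_diag_index)
  also have "\<dots> = sym_lower l1 \<epsilon> 0 $$ (i, i) * X $$ (i, j) * sym_lower l2 (cj \<epsilon>) 0 $$ (j, j)"
    using i by (intro sum_single) (auto simp: sym_lower_diag_index)
  finally show ?thesis using i j by (simp add: sym_lower_diag_index weight_def)
qed

text \<open>The sign shared by all weights. As the norm of epsilon is 1 or -1 and l1, l2 have equal
  parity, the exponent l1 would give the same sign.\<close>

abbreviation "sgn0 \<equiv> quad_norm d \<epsilon> ^ l2"
abbreviation "m \<equiv> (l1 - l2) div 2"

lemma l1_eq: "l1 = l2 + 2 * m"
proof -
  have "2 dvd l1 - l2" using l_cong l2_le by (simp add: cong_altdef_nat)
  hence "2 * m = l1 - l2" by (rule dvd_mult_div_cancel)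
  thus ?thesis using l2_le by simp
qed

lemma sgn0_cases: "sgn0 = 1 \<or> sgn0 = -1"
  using quad_units_norm[OF eps(1)] by (cases "even l2") auto

text \<open>epsilon' = s / epsilon with s = 1/s, so the signs collect to s^l2 and the exponents of
  epsilon to (l1 - i) - i - (l2 - j) + j = 2 (j + m - i).\<close>

lemma weight_eq: 
  assumes i: "i \<le> l1" and j: "j \<le> l2"
  shows "weight i j = sgn0 * \<epsilon> powi (2 * (int j + int m - int i))"
proof -
  define s where "s = quad_norm d \<epsilon>"
  have e0: "\<epsilon> \<noteq> 0" using eps by simp
  have s: "s = 1 \<or> s = -1" unfolding s_def by (rule quad_units_norm[OF eps(1)])
  have c: "cj \<epsilon> = s * inverse \<epsilon>" unfolding s_def quad_norm_def using e0 by simp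
  have "s ^ (l2 - j) * inverse s ^ j = s ^ l2"
  proof -
    have "inverse s = s" using s by auto
    hence "s ^ (l2 - j) * inverse s ^ j = s ^ (l2 - j + j)" by (simp only: power_add)
    thus ?thesis using j by simp
  qed
  moreover have "weight i j = (s ^ (l2 - j) * inverse s ^ j) * (\<epsilon> ^ (l1 - i) * inverse \<epsilon> ^ i * (inverse \<epsilon> ^ (l2 - j) * \<epsilon> ^ j))"
    unfolding weight_def c by (simp add: power_mult_distrib mult_ac)
  moreover have "\<epsilon> ^ (l1 - i) * inverse \<epsilon> ^ i * (inverse \<epsilon> ^ (l2 - j) * \<epsilon> ^ j) = \<epsilon> powi (2 * (int j + int m - int i))"
  proof -
    have "2 * (int j + int m - int i) = int (l1 - i) - int i - int (l2 - j) + int j"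
      using i j l1_eq by (simp add: of_nat_diff)
    thus ?thesis using e0 by (simp only: power_int_diff power_int_add power_int_of_nat simp_thms)
        (simp add: field_simps)
  qed
  ultimately show ?thesis unfolding s_def by simp
qed

definition "\<mu> = inverse (\<epsilon> ^ 2)"

lemma mu: "\<mu> > 0" "\<mu> < 1"
  unfolding \<mu>_def using eps(2) by (auto simp: one_less_power inverse_less_1_iff)

text \<open>Only the square of the norm enters, so the conjugate of mu is 1/mu for either sign of
  N(epsilon).\<close>

lemma mu_mult:
  assumes "u \<in> \<O>"
  shows "\<mu> * u \<in> \<O>" "cj (\<mu> * u) = inverse \<mu> * cj u"
proof -
  have e: "inverse \<epsilon> \<in> \<O>" by (rule quad_unitsD(2)[OF eps(1)])
  have m: "\<mu> = inverse \<epsilon> * inverse \<epsilon>" unfolding \<mu>_def by (simp add: power2_eq_square)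
  show "\<mu> * u \<in> \<O>" unfolding m using e assms by (intro quad_ints_mult)
  have "(\<epsilon> * cj \<epsilon>) * (\<epsilon> * cj \<epsilon>) = 1"
    using quad_units_norm[OF eps(1)] unfolding quad_norm_def by auto
  hence "inverse (cj \<epsilon>) * inverse (cj \<epsilon>) = \<epsilon> * \<epsilon>"
    using quad_unitsD(5)[OF eps(1)] by (simp add: field_simps)
  hence "cj \<mu> = inverse \<mu>"
    unfolding m using e quad_unitsD(6)[OF eps(1)] by (simp add: quad_conj_mult)
  thus "cj (\<mu> * u) = inverse \<mu> * cj u"
    using quad_conj_mult[of \<mu> u] e assms quad_ints_mult[OF e e] m by simp
qed

lemma weight_Suc: "Suc i \<le> l1 \<Longrightarrow> j \<le> l2 \<Longrightarrow> weight (Suc i) j = \<mu> * weight i j"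
proof -
  assume a: "Suc i \<le> l1" "j \<le> l2"
  have "2 * (int j + int m - int (Suc i)) = 2 * (int j + int m - int i) - 2" by simp
  hence "\<epsilon> powi (2 * (int j + int m - int (Suc i))) = \<epsilon> powi (2 * (int j + int m - int i) - 2)"
    by (rule arg_cong)
  also have "\<dots> = \<epsilon> powi (2 * (int j + int m - int i)) / \<epsilon> powi 2"
    by (rule power_int_diff) (use eps(2) in simp)
  finally have "\<epsilon> powi (2 * (int j + int m - int (Suc i))) = \<epsilon> powi (2 * (int j + int m - int i)) / \<epsilon> powi 2" .
  thus ?thesis using a by (simp add: weight_eq \<mu>_def field_simps power_int_numeral)
qed

text \<open>Powers of epsilon > 1 are distinct and positive. A sign -1 therefore excludes all three
  values; otherwise exponents are compared, 1, mu and 1/mu having the exponents 0, -2 and 2.\<close>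

lemma weight_special:
  assumes i: "i \<le> l1" and j: "j \<le> l2"
  shows "weight i j = 1 \<longleftrightarrow> sgn0 = 1 \<and> i = j + m"
    "weight i j = \<mu> \<longleftrightarrow> sgn0 = 1 \<and> i = j + m + 1"
    "weight i j = inverse \<mu> \<longleftrightarrow> sgn0 = 1 \<and> i + 1 = j + m"
proof -
  have key: "weight i j = \<epsilon> powi (2 * k) \<longleftrightarrow> sgn0 = 1 \<and> int j + int m - int i = k" for k
  proof (cases "sgn0 = 1")
    case True
    have "\<epsilon> powi (2 * (int j + int m - int i)) = \<epsilon> powi (2 * k) \<longleftrightarrow> int j + int m - int i = k"
      using power_int_inj_gt_1[OF eps(2), of "2 * (int j + int m - int i)" "2 * k"] by auto
    thus ?thesis using True i j by (simp only: weight_eq) simp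
  next
    case False
    hence "weight i j < 0" using sgn0_cases eps(2) i j by (auto simp: weight_eq)
    moreover have "\<epsilon> powi (2 * k) > 0" using eps(2) by simp
    ultimately show ?thesis using False by auto
  qed
  have "\<epsilon> powi (2 * 0) = 1" "\<epsilon> powi (2 * -1) = \<mu>" "\<epsilon> powi (2 * 1) = inverse \<mu>"
    unfolding \<mu>_def by (simp_all add: power_int_minus)
  thus "weight i j = 1 \<longleftrightarrow> sgn0 = 1 \<and> i = j + m"
    "weight i j = \<mu> \<longleftrightarrow> sgn0 = 1 \<and> i = j + m + 1"
    "weight i j = inverse \<mu> \<longleftrightarrow> sgn0 = 1 \<and> i + 1 = j + m"
    using key[of 0] key[of "-1"] key[of 1] by auto
qed

subsection \<open>Normalisation of cocycles\<close>

text \<open>The functions u and u' are independent eigenfunctions of the substitution u -> mu u,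
  with eigenvalues mu and 1/mu, so a nonzero coefficient determines the eigenvalue.\<close>

lemma eigen_additive:
  fixes f :: "real \<Rightarrow> complex"
  assumes add: "\<And>u v. u \<in> \<O> \<Longrightarrow> v \<in> \<O> \<Longrightarrow> f (u + v) = f u + f v"
    and eig: "\<And>u. u \<in> \<O> \<Longrightarrow> f (\<mu> * u) = of_real \<Lambda> * f u"
  obtains \<alpha> \<beta> where "\<And>u. u \<in> \<O> \<Longrightarrow> f u = \<alpha> * of_real u + \<beta> * of_real (cj u)"
    "\<alpha> \<noteq> 0 \<Longrightarrow> \<Lambda> = \<mu>" "\<beta> \<noteq> 0 \<Longrightarrow> \<Lambda> = inverse \<mu>"
proof -
  obtain \<alpha> \<beta> where f: "\<And>u. u \<in> \<O> \<Longrightarrow> f u = \<alpha> * of_real u + \<beta> * of_real (cj u)"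
    using additive_on_quad_ints[OF add] by blast
  have z: "(\<alpha> * of_real (\<mu> - \<Lambda>)) * of_real u + (\<beta> * of_real (inverse \<mu> - \<Lambda>)) * of_real (cj u) = 0"
    if u: "u \<in> \<O>" for u
    using eig[OF u] f[OF u] f[OF mu_mult(1)[OF u]] mu_mult(2)[OF u] by (simp add: algebra_simps)
  have "\<alpha> * of_real (\<mu> - \<Lambda>) = 0" "\<beta> * of_real (inverse \<mu> - \<Lambda>) = 0"
    using quad_conj_independent[OF z] by blast+
  hence "\<alpha> \<noteq> 0 \<Longrightarrow> \<Lambda> = \<mu>" "\<beta> \<noteq> 0 \<Longrightarrow> \<Lambda> = inverse \<mu>"
    by (simp_all only: mult_eq_0_iff of_real_eq_0_iff) auto
  with f that show ?thesis by blast
qed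

lemma Z1D:
  assumes "f \<in> Z1"
  shows "g \<in> carrier P \<Longrightarrow> f g \<in> CM"
    "g \<in> carrier P \<Longrightarrow> h \<in> carrier P \<Longrightarrow> f (g \<otimes>\<^bsub>P\<^esub> h) = f g + act g (f h)"
  using assms unfolding cocycles1_def VV_simps by auto

lemma Z1_diff:
  assumes f: "f \<in> Z1" and h: "h \<in> Z1"
  shows "(\<lambda>g\<in>carrier P. f g - h g) \<in> Z1"
proof -
  have "f (g \<otimes>\<^bsub>P\<^esub> k) - h (g \<otimes>\<^bsub>P\<^esub> k) = f g - h g + act g (f k - h k)"
    if gk: "g \<in> carrier P" "k \<in> carrier P" for g k
  proof -
    note fc = Z1D(1)[OF f] and hc = Z1D(1)[OF h]
    have "act g (f k) \<in> CM" "act g (h k) \<in> CM" using gk fc hc by (auto intro: act_closed)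
    thus ?thesis
      unfolding Z1D(2)[OF f gk] Z1D(2)[OF h gk] act_diff[OF gk(1) fc[OF gk(2)] hc[OF gk(2)]]
      using fc[OF gk(1)] hc[OF gk(1)] by (intro eq_matI) auto
  qed
  moreover have "f g - h g \<in> CM" if "g \<in> carrier P" for g
    using Z1D(1)[OF h that] by (rule minus_carrier_mat)
  ultimately show ?thesis unfolding cocycles1_def VV_simps by (simp add: parabolic_closed)
qed

lemma Z1_smult:
  assumes f: "f \<in> Z1"
  shows "(\<lambda>g\<in>carrier P. c \<cdot>\<^sub>m f g) \<in> Z1"
proof -
  have "c \<cdot>\<^sub>m f (g \<otimes>\<^bsub>P\<^esub> k) = c \<cdot>\<^sub>m f g + act g (c \<cdot>\<^sub>m f k)"
    if gk: "g \<in> carrier P" "k \<in> carrier P" for g k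
  proof -
    have "act g (f k) \<in> CM" using gk Z1D(1)[OF f] by (auto intro: act_closed)
    thus ?thesis
      unfolding Z1D(2)[OF f gk] act_smult[OF gk(1) Z1D(1)[OF f gk(2)]]
      using Z1D(1)[OF f gk(1)] by (intro eq_matI) (auto simp: algebra_simps)
  qed
  moreover have "c \<cdot>\<^sub>m f g \<in> CM" if "g \<in> carrier P" for g
    using Z1D(1)[OF f that] by simp
  ultimately show ?thesis unfolding cocycles1_def VV_simps by (simp add: parabolic_closed)
qed

text \<open>The representative of the same class reached by the correction V; restriction keeps it
  extensional, hence a cochain.\<close>

definition shift :: "(real mat set \<Rightarrow> complex mat) \<Rightarrow> complex mat \<Rightarrow> real mat set \<Rightarrow> complex mat" where
  "shift f V = (\<lambda>g\<in>carrier P. f g - (act g V - V))"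

lemma shift_Z1:
  assumes f: "f \<in> Z1" and V: "V \<in> CM"
  shows "shift f V \<in> Z1"
proof -
  have "(\<lambda>g\<in>carrier P. act g V \<ominus>\<^bsub>VV\<^esub> V) \<in> Z1"
    using linear_group_action.coboundary_cocycle[OF linear_action] V unfolding VV_simps by blast
  from Z1_diff[OF f this] show ?thesis
    using V by (simp add: shift_def VV_minus act_closed cong: restrict_cong)
qed

text \<open>Coboundaries are additive in V, so a chain of corrections is recorded by one
  matrix.\<close>

lemma shift_shift:
  assumes f: "f \<in> Z1" and V: "V \<in> CM" and W: "W \<in> CM"
  shows "shift (shift f V) W = shift f (V + W)"
  unfolding shift_def
proof (rule restrict_ext)
  fix g assume g: "g \<in> carrier P"
  have "f g - (act g V - V) - (act g W - W) = f g - (act g V + act g W - (V + W))"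
    using Z1D(1)[OF f g] V W act_closed[OF g V] act_closed[OF g W] by (intro eq_matI) auto
  thus "(\<lambda>g\<in>carrier P. f g - (act g V - V)) g - (act g W - W) = f g - (act g (V + W) - (V + W))"
    using g act_add[OF g V W] by simp
qed

lemma N_closed: "u \<in> \<O> \<Longrightarrow> N u \<in> carrier P"
  by (rule par_elem_closed[OF quad_units_1])

lemma T_closed: "T \<in> carrier P"
  by (rule par_elem_closed[OF eps(1) quad_ints_0])

lemma Z1_N_add:
  assumes "f \<in> Z1" "u \<in> \<O>" "v \<in> \<O>"
  shows "f (N (u + v)) = f (N u) + act (N u) (f (N v))"
  using Z1D(2)[OF assms(1) N_closed[OF assms(2)] N_closed[OF assms(3)]] by (simp add: par_elem_mult)

text \<open>Both sides are the value of f at T N(u) = N(mu u) T. All eigenvalue relations between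
  entries come from this identity.\<close>

lemma Z1_TN:
  assumes f: "f \<in> Z1" and u: "u \<in> \<O>"
  shows "f T + act T (f (N u)) = f (N (\<mu> * u)) + act (N (\<mu> * u)) (f T)"
proof -
  have "\<mu> * u * \<epsilon> = inverse \<epsilon> * u" using eps(2) by (simp add: \<mu>_def power2_eq_square)
  moreover have "T \<otimes>\<^bsub>P\<^esub> N u = par_elem \<epsilon> (inverse \<epsilon> * u)"
    "N (\<mu> * u) \<otimes>\<^bsub>P\<^esub> T = par_elem \<epsilon> (\<mu> * u * \<epsilon>)" by (simp_all add: par_elem_mult)
  ultimately have "T \<otimes>\<^bsub>P\<^esub> N u = N (\<mu> * u) \<otimes>\<^bsub>P\<^esub> T" by (simp only:)
  thus ?thesis
    using Z1D(2)[OF f T_closed N_closed[OF u]] Z1D(2)[OF f N_closed[OF mu_mult(1)[OF u]] T_closed] by simp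
qed

text \<open>
  Entries are ordered column by column: $(p,q)$ precedes $(n,j)$ if $q < j$, or $q = j$ and $p < n$.
\<close>

definition zero_before :: "complex mat \<Rightarrow> nat \<Rightarrow> nat \<Rightarrow> bool" where
  "zero_before X n j \<longleftrightarrow> (\<forall>p\<le>l1. \<forall>q\<le>l2. q < j \<or> q = j \<and> p < n \<longrightarrow> X $$ (p, q) = 0)"

lemma zero_beforeD: "zero_before X n j \<Longrightarrow> p \<le> l1 \<Longrightarrow> q \<le> l2 \<Longrightarrow> q < j \<or> q = j \<and> p < n \<Longrightarrow> X $$ (p, q) = 0"
  unfolding zero_before_def by blast

lemma zero_before_mono: "zero_before X n j \<Longrightarrow> q < j \<or> q = j \<and> p \<le> n \<Longrightarrow> zero_before X p q"
  unfolding zero_before_def by force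

lemma zero_before_Suc: "zero_before X n j \<Longrightarrow> X $$ (n, j) = 0 \<Longrightarrow> zero_before X (Suc n) j"
  unfolding zero_before_def by (auto simp: less_Suc_eq)

lemma zero_before_next_column:
  assumes "zero_before X (Suc l1) j"
  shows "zero_before X 0 (Suc j)"
  unfolding zero_before_def
proof (intro allI impI)
  fix p q assume pq: "p \<le> l1" "q \<le> l2" "q < Suc j \<or> q = Suc j \<and> p < 0"
  hence "q < j \<or> q = j \<and> p < Suc l1" by auto
  thus "X $$ (p, q) = 0" by (rule zero_beforeD[OF assms pq(1,2)])
qed

lemma act_N_first:
  assumes X: "X \<in> CM" and v: "zero_before X n j" and nj: "n \<le> l1" "j \<le> l2" and u: "u \<in> \<O>"
  shows "act (N u) X $$ (n, j) = X $$ (n, j)"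
proof -
  have "act (N u) X $$ (n, j) = (\<Sum>k\<le>n. of_nat (n choose k) * of_real u ^ (n - k) * X $$ (k, j))"
    using zero_beforeD[OF v] nj by (intro act_N_index u X) auto
  also have "\<dots> = (\<Sum>k<n. of_nat (n choose k) * of_real u ^ (n - k) * X $$ (k, j)) + X $$ (n, j)"
    by (simp flip: lessThan_Suc_atMost)
  also have "(\<Sum>k<n. of_nat (n choose k) * of_real u ^ (n - k) * X $$ (k, j)) = 0"
    using zero_beforeD[OF v] nj by (intro sum.neutral) auto
  finally show ?thesis by simp
qed

text \<open>Directly below the first possibly nonzero entry two binomial terms survive, k = n and k
  = n + 1. The extra term is the coupling that settles the exceptional weights.\<close>

lemma act_N_second:
  assumes X: "X \<in> CM" and v: "zero_before X n j" and nj: "Suc n \<le> l1" "j \<le> l2" and u: "u \<in> \<O>"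
  shows "act (N u) X $$ (Suc n, j) = X $$ (Suc n, j) + of_nat (Suc n) * of_real u * X $$ (n, j)"
proof -
  have "act (N u) X $$ (Suc n, j) =
    (\<Sum>k\<le>Suc n. of_nat (Suc n choose k) * of_real u ^ (Suc n - k) * X $$ (k, j))"
    using zero_beforeD[OF v] nj by (intro act_N_index u X) auto
  also have "\<dots> = (\<Sum>k<n. of_nat (Suc n choose k) * of_real u ^ (Suc n - k) * X $$ (k, j))
      + of_nat (Suc n) * of_real u * X $$ (n, j) + X $$ (Suc n, j)"
    by (simp del: binomial_Suc_Suc of_nat_Suc flip: lessThan_Suc_atMost)
  also have "(\<Sum>k<n. of_nat (Suc n choose k) * of_real u ^ (Suc n - k) * X $$ (k, j)) = 0"
    using zero_beforeD[OF v] nj by (intro sum.neutral) auto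
  finally show ?thesis by simp
qed

text \<open>At each earlier position everything before it vanishes too, so \<open>N u\<close> fixes
  the entry there, and that entry is 0.\<close>

lemma zero_before_act_N:
  assumes X: "X \<in> CM" and v: "zero_before X n j" and u: "u \<in> \<O>"
  shows "zero_before (act (N u) X) n j"
  unfolding zero_before_def
proof (intro allI impI)
  fix p q assume pq: "p \<le> l1" "q \<le> l2" "q < j \<or> q = j \<and> p < n"
  have "zero_before X p q" using v by (rule zero_before_mono) (use pq(3) in auto)
  thus "act (N u) X $$ (p, q) = 0" using act_N_first[OF X _ pq(1,2) u] zero_beforeD[OF v pq] by simp
qed

lemma zero_before_act_T: "X \<in> CM \<Longrightarrow> zero_before X n j \<Longrightarrow> zero_before (act T X) n j"
  unfolding zero_before_def by (auto simp: act_T_index)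

text \<open>Only generators are inspected; a cocycle vanishing on them vanishes, by
  \<open>Z1_zero_of_generators\<close>.\<close>

definition gens_zero_before :: "(real mat set \<Rightarrow> complex mat) \<Rightarrow> nat \<Rightarrow> nat \<Rightarrow> bool" where
  "gens_zero_before f n j \<longleftrightarrow> zero_before (f T) n j \<and> (\<forall>u\<in>\<O>. zero_before (f (N u)) n j)"

lemma gens_zero_before_Suc:
  "gens_zero_before f n j \<Longrightarrow> f T $$ (n, j) = 0 \<Longrightarrow> (\<And>u. u \<in> \<O> \<Longrightarrow> f (N u) $$ (n, j) = 0) \<Longrightarrow> gens_zero_before f (Suc n) j"
  unfolding gens_zero_before_def by (auto intro: zero_before_Suc)

lemma zero_before_shift:
  assumes "X \<in> CM" "Y \<in> CM" "V \<in> CM" "zero_before X n j" "zero_before Y n j" "zero_before V n j"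
  shows "zero_before (X - (Y - V)) n j"
  using assms unfolding zero_before_def by auto

lemma gens_zero_before_shift:
  assumes f: "f \<in> Z1" and v: "gens_zero_before f n j" and V: "V \<in> CM" "zero_before V n j"
  shows "gens_zero_before (shift f V) n j"
  using assms T_closed N_closed unfolding gens_zero_before_def shift_def
  by (auto intro!: zero_before_shift Z1D act_closed zero_before_act_T zero_before_act_N)

lemma shift_T_entry:
  assumes f: "f \<in> Z1" and V: "V \<in> CM" and nj: "n \<le> l1" "j \<le> l2"
  shows "shift f V T $$ (n, j) = f T $$ (n, j) - (of_real (weight n j) - 1) * V $$ (n, j)"
  using V nj T_closed Z1D(1)[OF f T_closed] act_closed[OF T_closed V]
  by (simp add: shift_def act_T_index algebra_simps)

lemma shift_N_first:
  assumes f: "f \<in> Z1" and V: "V \<in> CM" "zero_before V n j" and nj: "n \<le> l1" "j \<le> l2" and u: "u \<in> \<O>"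
  shows "shift f V (N u) $$ (n, j) = f (N u) $$ (n, j)"
  using V nj N_closed[OF u] Z1D(1)[OF f N_closed[OF u]] act_closed[OF N_closed[OF u] V(1)]
  by (simp add: shift_def act_N_first[OF V nj u])

text \<open>The change is a multiple of u, so such a correction can cancel a function alpha u but
  not beta u'.\<close>

lemma shift_N_second:
  assumes f: "f \<in> Z1" and V: "V \<in> CM" "zero_before V n j" and nj: "Suc n \<le> l1" "j \<le> l2" and u: "u \<in> \<O>"
  shows "shift f V (N u) $$ (Suc n, j) = f (N u) $$ (Suc n, j) - of_nat (Suc n) * of_real u * V $$ (n, j)"
  using V nj N_closed[OF u] Z1D(1)[OF f N_closed[OF u]] act_closed[OF N_closed[OF u] V(1)]
  by (simp add: shift_def act_N_second[OF V nj u])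

definition elem_mat :: "nat \<Rightarrow> nat \<Rightarrow> complex \<Rightarrow> complex mat" where
  "elem_mat n j a = mat (Suc l1) (Suc l2) (\<lambda>(p, q). if p = n \<and> q = j then a else 0)"

lemma elem_mat_dim [simp]: "dim_row (elem_mat n j a) = Suc l1" "dim_col (elem_mat n j a) = Suc l2"
  unfolding elem_mat_def by simp_all

lemma elem_mat [simp]:
  "elem_mat n j a \<in> CM" "zero_before (elem_mat n j a) n j"
  "n \<le> l1 \<Longrightarrow> j \<le> l2 \<Longrightarrow> elem_mat n j a $$ (n, j) = a"
  "p \<le> l1 \<Longrightarrow> q \<le> l2 \<Longrightarrow> elem_mat n j a $$ (p, q) = (if p = n \<and> q = j then a else 0)"
  unfolding elem_mat_def zero_before_def by auto

section \<open>The first unnormalised entry and the entry below it\<close>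

context
  fixes f n j
  assumes f: "f \<in> Z1" and v: "gens_zero_before f n j" and nj: "n \<le> l1" "j \<le> l2"
begin

lemma entry_add:
  assumes "u \<in> \<O>" "w \<in> \<O>"
  shows "f (N (u + w)) $$ (n, j) = f (N u) $$ (n, j) + f (N w) $$ (n, j)"
proof -
  note c = Z1D(1)[OF f N_closed]
  have "act (N u) (f (N w)) $$ (n, j) = f (N w) $$ (n, j)"
    using v assms nj c by (intro act_N_first) (auto simp: gens_zero_before_def)
  thus ?thesis unfolding Z1_N_add[OF f assms]
    using nj c assms act_closed[OF N_closed[OF assms(1)] c[OF assms(2)]] by simp
qed

text \<open>In \<open>Z1_TN\<close> the entry of f(T) occurs on both sides and cancels, since N(mu
  u) fixes the first possibly nonzero entry.\<close>

lemma entry_eigen: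
  assumes u: "u \<in> \<O>"
  shows "f (N (\<mu> * u)) $$ (n, j) = of_real (weight n j) * f (N u) $$ (n, j)"
proof -
  have mu': "\<mu> * u \<in> \<O>" by (rule mu_mult[OF u])
  note c = Z1D(1)[OF f N_closed[OF u]] Z1D(1)[OF f T_closed] Z1D(1)[OF f N_closed[OF mu']]
  have 1: "act (N (\<mu> * u)) (f T) $$ (n, j) = f T $$ (n, j)"
    using v nj c mu' by (intro act_N_first) (auto simp: gens_zero_before_def)
  have 2: "act T (f (N u)) $$ (n, j) = of_real (weight n j) * f (N u) $$ (n, j)"
    using c nj by (intro act_T_index)
  have "(f T + act T (f (N u))) $$ (n, j) = (f (N (\<mu> * u)) + act (N (\<mu> * u)) (f T)) $$ (n, j)"
    by (simp only: Z1_TN[OF f u])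
  thus ?thesis
    using nj c act_closed[OF T_closed c(1)] act_closed[OF N_closed[OF mu'] c(2)] 1 2 by simp
qed

text \<open>The left side is symmetric in u and w, the last term is not; this asymmetry constrains
  the entry above.\<close>

lemma entry_Suc_add:
  assumes "Suc n \<le> l1" "u \<in> \<O>" "w \<in> \<O>"
  shows "f (N (u + w)) $$ (Suc n, j) = f (N u) $$ (Suc n, j) + f (N w) $$ (Suc n, j)
    + of_nat (Suc n) * of_real u * f (N w) $$ (n, j)"
proof -
  note c = Z1D(1)[OF f N_closed]
  have "act (N u) (f (N w)) $$ (Suc n, j) =
      f (N w) $$ (Suc n, j) + of_nat (Suc n) * of_real u * f (N w) $$ (n, j)"
    using v assms nj c by (intro act_N_second) (auto simp: gens_zero_before_def)
  thus ?thesis unfolding Z1_N_add[OF f assms(2,3)]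
    using nj c assms act_closed[OF N_closed[OF assms(2)] c[OF assms(3)]] by (simp del: of_nat_Suc)
qed

text \<open>One row lower N(mu u) no longer fixes the entry of f(T): the entry itself still cancels,
  but the coupling to (n,j) remains.\<close>

lemma entry_Suc_eigen:
  assumes n: "Suc n \<le> l1" and u: "u \<in> \<O>"
  shows "of_real (weight (Suc n) j) * f (N u) $$ (Suc n, j) =
    f (N (\<mu> * u)) $$ (Suc n, j) + of_nat (Suc n) * of_real (\<mu> * u) * f T $$ (n, j)"
proof -
  have mu': "\<mu> * u \<in> \<O>" by (rule mu_mult[OF u])
  note c = Z1D(1)[OF f N_closed[OF u]] Z1D(1)[OF f T_closed] Z1D(1)[OF f N_closed[OF mu']]
  have 1: "act (N (\<mu> * u)) (f T) $$ (Suc n, j) =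
      f T $$ (Suc n, j) + of_nat (Suc n) * of_real (\<mu> * u) * f T $$ (n, j)"
    using v nj n c mu' by (intro act_N_second) (auto simp: gens_zero_before_def)
  have 2: "act T (f (N u)) $$ (Suc n, j) = of_real (weight (Suc n) j) * f (N u) $$ (Suc n, j)"
    using c nj n by (intro act_T_index)
  have "(f T + act T (f (N u))) $$ (Suc n, j) = (f (N (\<mu> * u)) + act (N (\<mu> * u)) (f T)) $$ (Suc n, j)"
    by (simp only: Z1_TN[OF f u])
  thus ?thesis
    using nj n c act_closed[OF T_closed c(1)] act_closed[OF N_closed[OF mu'] c(2)] 1 2
    by (simp del: of_nat_Suc)
qed

text \<open>A multiple of the matrix unit at (n,j) changes the entry of f(T) by weight - 1 times its
  coefficient and leaves the entry of f(N(u)) alone.\<close>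

lemma kill_T_entry:
  assumes "\<And>u. u \<in> \<O> \<Longrightarrow> f (N u) $$ (n, j) = 0" and "weight n j \<noteq> 1"
  shows "\<exists>V\<in>CM. gens_zero_before (shift f V) (Suc n) j"
proof (intro bexI gens_zero_before_Suc)
  let ?V = "elem_mat n j (f T $$ (n, j) / (of_real (weight n j) - 1))"
  show "?V \<in> CM" by simp
  show "gens_zero_before (shift f ?V) n j" using f v by (intro gens_zero_before_shift) auto
  have "complex_of_real (weight n j) \<noteq> 1" using assms(2) by (metis of_real_eq_1_iff)
  thus "shift f ?V T $$ (n, j) = 0" using nj by (simp add: shift_T_entry[OF f])
  show "shift f ?V (N u) $$ (n, j) = 0" if "u \<in> \<O>" for u
    using shift_N_first[OF f _ _ nj that] assms(1)[OF that] by simp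
qed

lemma entry_zero_of_eigen:
  assumes "weight n j \<noteq> \<mu>" and "weight n j = inverse \<mu> \<Longrightarrow> Suc n \<le> l1" and u: "u \<in> \<O>"
  shows "f (N u) $$ (n, j) = 0"
proof -
  obtain \<alpha> \<beta> where F: "\<And>u. u \<in> \<O> \<Longrightarrow> f (N u) $$ (n, j) = \<alpha> * of_real u + \<beta> * of_real (cj u)"
    and \<alpha>: "\<alpha> \<noteq> 0 \<Longrightarrow> weight n j = \<mu>" and \<beta>: "\<beta> \<noteq> 0 \<Longrightarrow> weight n j = inverse \<mu>"
    using eigen_additive[of "\<lambda>u. f (N u) $$ (n, j)" "weight n j"] entry_add entry_eigen by metis
  have "\<alpha> = 0" using \<alpha> assms(1) by blast
  moreover have "\<beta> = 0"
  proof (rule ccontr)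
    assume b: "\<beta> \<noteq> 0"
    hence n: "Suc n \<le> l1" using \<beta> assms(2) by blast
    have "of_nat (Suc n) * of_real x * f (N y) $$ (n, j) = of_nat (Suc n) * of_real y * f (N x) $$ (n, j)"
      if "x \<in> \<O>" "y \<in> \<O>" for x y
      using entry_Suc_add[OF n that] entry_Suc_add[OF n that(2,1)] by (simp add: add.commute)
    \<comment> \<open>With alpha = 0 the two sides are -beta sqrt d and beta sqrt d, because
      conjugation changes the sign of sqrt d.\<close>
    from this[of 1 \<delta>] have "f (N \<delta>) $$ (n, j) = of_real \<delta> * f (N 1) $$ (n, j)"
      by (simp del: of_nat_Suc)
    hence "\<beta> * of_real \<delta> = 0" using F[of 1] F[of \<delta>] \<open>\<alpha> = 0\<close> by simp
    thus False using b d_gt_1 by simp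
  qed
  ultimately show ?thesis using F[OF u] by simp
qed

lemma generic_step:
  assumes "weight n j \<noteq> 1" "weight n j \<noteq> \<mu>" "weight n j = inverse \<mu> \<Longrightarrow> Suc n \<le> l1"
  shows "\<exists>V\<in>CM. gens_zero_before (shift f V) (Suc n) j"
  using assms entry_zero_of_eigen by (intro kill_T_entry) auto

end

text \<open>The step lemmas start from a cocycle that is already normalised so far; this chains them
  for the original f.\<close>

lemma shift_compose:
  assumes f: "f \<in> Z1" and 1: "\<exists>V\<in>CM. gens_zero_before (shift f V) n j"
    and 2: "\<And>h. h \<in> Z1 \<Longrightarrow> gens_zero_before h n j \<Longrightarrow> \<exists>V\<in>CM. gens_zero_before (shift h V) n' j'"
  shows "\<exists>V\<in>CM. gens_zero_before (shift f V) n' j'"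
proof -
  obtain V where V: "V \<in> CM" "gens_zero_before (shift f V) n j" using 1 by blast
  obtain W where W: "W \<in> CM" "gens_zero_before (shift (shift f V) W) n' j'"
    using 2[OF shift_Z1[OF f V(1)] V(2)] by blast
  have "gens_zero_before (shift f (V + W)) n' j'" using W(2) unfolding shift_shift[OF f V(1) W(1)] .
  moreover have "V + W \<in> CM" using V W by simp
  ultimately show ?thesis by blast
qed

text \<open>Zero is the exponent of epsilon at weight 1. Two rows are cleared together, because the
  coefficient of the correction at (n,j), invisible to T there, is spent on the entry of weight mu
  below.\<close>

lemma weight_zero_step:
  assumes f: "f \<in> Z1" and v: "gens_zero_before f n j" and nj: "Suc n \<le> l1" "j \<le> l2" and weight1: "weight n j = 1"
  shows "\<exists>V\<in>CM. gens_zero_before (shift f V) (Suc (Suc n)) j"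
proof -
  have n: "n \<le> l1" using nj by simp
  have "\<mu> \<noteq> 1" "inverse \<mu> \<noteq> 1" using mu by auto
  hence F0: "f (N u) $$ (n, j) = 0" if "u \<in> \<O>" for u
    using weight1 nj that by (intro entry_zero_of_eigen[OF f v n]) auto
  have weight_S: "weight (Suc n) j = \<mu>" using weight_Suc[OF nj] weight1 by simp
  define G where "G u = f (N u) $$ (Suc n, j)" for u
  have G_add: "G (u + w) = G u + G w" if "u \<in> \<O>" "w \<in> \<O>" for u w
    using entry_Suc_add[OF f v n nj(2,1) that] F0[OF that(2)] by (simp add: G_def)
  obtain \<alpha> \<beta> where G: "\<And>u. u \<in> \<O> \<Longrightarrow> G u = \<alpha> * of_real u + \<beta> * of_real (cj u)"
    using additive_on_quad_ints[OF G_add] by blast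
  \<comment> \<open>In mu G(u) = G(mu u) + (n + 1) mu u f_nj(T) the alpha terms cancel, so the u
    part isolates f_nj(T) and the u' part isolates beta.\<close>
  have z: "(- of_nat (Suc n) * of_real \<mu> * f T $$ (n, j)) * of_real u + (\<beta> * of_real (\<mu> - inverse \<mu>)) * of_real (cj u) = 0"
    if u: "u \<in> \<O>" for u
  proof -
    have "of_real \<mu> * G u = G (\<mu> * u) + of_nat (Suc n) * of_real (\<mu> * u) * f T $$ (n, j)"
      using entry_Suc_eigen[OF f v n nj(2,1) u] by (simp add: G_def weight_S)
    thus ?thesis using G[OF u] G[OF mu_mult(1)[OF u]] mu_mult(2)[OF u]
      by (simp add: algebra_simps del: of_nat_Suc)
  qed
  have "- of_nat (Suc n) * of_real \<mu> * f T $$ (n, j) = 0" and \<beta>: "\<beta> * of_real (\<mu> - inverse \<mu>) = 0"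
    using quad_conj_independent[OF z] by blast+
  hence T0: "f T $$ (n, j) = 0" using mu(1) by (simp del: of_nat_Suc)
  have "\<mu> < inverse \<mu>" using mu by (metis less_trans one_less_inverse)
  hence "complex_of_real (\<mu> - inverse \<mu>) \<noteq> 0" by (metis less_irrefl of_real_eq_0_iff right_minus_eq)
  hence "\<beta> = 0" using \<beta> by simp
  \<comment> \<open>\<open>shift_N_second\<close> subtracts n + 1 times u times this coefficient,
    hence the division.\<close>
  define V where "V = elem_mat n j (\<alpha> / of_nat (Suc n))"
  have V: "V \<in> CM" "zero_before V n j" by (simp_all add: V_def)
  have "gens_zero_before (shift f V) (Suc n) j"
  proof (rule gens_zero_before_Suc)
    show "gens_zero_before (shift f V) n j" by (rule gens_zero_before_shift[OF f v V])
    show "shift f V T $$ (n, j) = 0" using shift_T_entry[OF f V(1) n nj(2)] T0 weight1 by simp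
    show "shift f V (N u) $$ (n, j) = 0" if "u \<in> \<O>" for u
      using shift_N_first[OF f V n nj(2) that] F0[OF that] by simp
  qed
  moreover have "shift f V (N u) $$ (Suc n, j) = 0" if u: "u \<in> \<O>" for u
  proof -
    have "V $$ (n, j) = \<alpha> / of_nat (Suc n)" using n nj by (simp add: V_def)
    thus ?thesis
      using shift_N_second[OF f V nj u] G[OF u] \<open>\<beta> = 0\<close> by (simp add: G_def del: of_nat_Suc)
  qed
  moreover have "weight (Suc n) j \<noteq> 1" using weight_S mu by simp
  \<comment> \<open>Row n + 1 has weight mu, different from 1, so its remaining T entry can be
    removed as well.\<close>
  ultimately obtain W where W: "W \<in> CM" "gens_zero_before (shift (shift f V) W) (Suc (Suc n)) j"
    using kill_T_entry[OF shift_Z1[OF f V(1)] _ nj] by blast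
  thus ?thesis unfolding shift_shift[OF f V(1) W(1)] using V(1) by (metis add_carrier_mat)
qed

text \<open>Above row j + m no weight is 1 or mu, and where it is 1/mu the row below is j + m <= l1.
  With sign -1 no weight is special, and n may pass the bottom of the column.\<close>

lemma reach_weight_zero:
  assumes f: "f \<in> Z1" and j: "j \<le> l2" and 0: "\<exists>V\<in>CM. gens_zero_before (shift f V) 0 j"
    and n: "n \<le> l1 + 1" "sgn0 = 1 \<Longrightarrow> n \<le> j + m"
  shows "\<exists>V\<in>CM. gens_zero_before (shift f V) n j"
  using n
proof (induction n)
  case (Suc n)
  have jm: "j + m \<le> l1" using j l1_eq by linarith
  show ?case
  proof (rule shift_compose[OF f])
    show "\<exists>V\<in>CM. gens_zero_before (shift f V) n j" by (rule Suc.IH) (use Suc.prems in force)+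
    fix h assume h: "h \<in> Z1" "gens_zero_before h n j"
    have n: "n \<le> l1" using Suc by simp
    show "\<exists>V\<in>CM. gens_zero_before (shift h V) (Suc n) j"
      using Suc.prems jm by (intro generic_step[OF h n j]) (auto simp: weight_special[OF n j])
  qed
qed (use 0 in simp)

text \<open>For sign 1 the hypothesis on j places row j + m + 1 inside the matrix, so that the rows
  of weight 1 and mu can be passed together.\<close>

lemma column_step:
  assumes f: "f \<in> Z1" and j: "j \<le> l2" and 0: "\<exists>V\<in>CM. gens_zero_before (shift f V) 0 j"
    and nd: "sgn0 = 1 \<Longrightarrow> j + m < l1"
  shows "\<exists>V\<in>CM. gens_zero_before (shift f V) 0 (Suc j)"
proof -
  have "\<exists>V\<in>CM. gens_zero_before (shift f V) (Suc l1) j"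
  proof (cases "sgn0 = 1")
    case False
    thus ?thesis by (intro reach_weight_zero[OF f j 0]) auto
  next
    case True
    hence q: "Suc (j + m) \<le> l1" using nd by simp
    have 1: "\<exists>V\<in>CM. gens_zero_before (shift f V) (j + m) j" using q by (intro reach_weight_zero[OF f j 0]) auto
    have 2: "\<exists>V\<in>CM. gens_zero_before (shift f V) (Suc (Suc (j + m))) j"
      using True q j by (intro shift_compose[OF f 1] weight_zero_step) (auto simp: weight_special)
    \<comment> \<open>Further down the weights are mu^k with k >= 2, so generic steps finish the
      column.\<close>
    have "\<exists>V\<in>CM. gens_zero_before (shift f V) n j" if "Suc (Suc (j + m)) \<le> n" "n \<le> Suc l1" for n
      using that
    proof (induction n rule: dec_induct)
      case base show ?case by (rule 2)
    next
      case (step n)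
      show ?case
      proof (rule shift_compose[OF f])
        show "\<exists>V\<in>CM. gens_zero_before (shift f V) n j" using step by simp
        fix h assume h: "h \<in> Z1" "gens_zero_before h n j"
        have n: "n \<le> l1" using step by simp
        show "\<exists>V\<in>CM. gens_zero_before (shift h V) (Suc n) j"
          using step by (intro generic_step[OF h n j]) (auto simp: weight_special[OF n j])
      qed
    qed
    thus ?thesis using q by simp
  qed
  moreover have "gens_zero_before h (Suc l1) j \<Longrightarrow> gens_zero_before h 0 (Suc j)" for h
    unfolding gens_zero_before_def by (auto intro: zero_before_next_column)
  ultimately show ?thesis by blast
qed

lemma columns_reach:
  assumes f: "f \<in> Z1" and J: "J \<le> Suc l2" and nd: "\<And>j. j < J \<Longrightarrow> sgn0 = 1 \<Longrightarrow> j + m < l1"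
  shows "\<exists>V\<in>CM. gens_zero_before (shift f V) 0 J"
  using J nd
proof (induction J)
  case 0
  have "gens_zero_before h 0 0" for h unfolding gens_zero_before_def zero_before_def by simp
  thus ?case by (meson zero_carrier_mat)
next
  case (Suc J)
  have "\<exists>V\<in>CM. gens_zero_before (shift f V) 0 J" using Suc by auto
  thus ?case using Suc.prems by (intro column_step[OF f]) auto
qed

subsection \<open>Dimension count\<close>

abbreviation "Zm \<equiv> 0\<^sub>m (Suc l1) (Suc l2) :: complex mat"

lemma quad_units_power: "t \<in> quad_units d \<Longrightarrow> t ^ n \<in> quad_units d"
  by (induction n) (auto intro: quad_units_mult quad_units_1)

text \<open>Natural powers of epsilon or of its inverse replace integer powers, which suits
  induction on the exponent.\<close>

lemma quad_units_cases:
  assumes "t \<in> quad_units d"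
  obtains k s where "s = \<epsilon> \<or> s = inverse \<epsilon>" "t = s ^ k \<or> t = - (s ^ k)"
proof -
  obtain n :: int where n: "t = \<epsilon> powi n \<or> t = - (\<epsilon> powi n)"
    using fund assms unfolding is_fundamental_unit_def by blast
  show ?thesis
  proof (cases "n \<ge> 0")
    case True
    hence "\<epsilon> powi n = \<epsilon> ^ nat n" by (simp add: power_int_def)
    thus ?thesis using n that[of \<epsilon> "nat n"] by simp
  next
    case False
    hence "\<epsilon> powi n = inverse \<epsilon> ^ nat (- n)" by (simp add: power_int_def)
    thus ?thesis using n that[of "inverse \<epsilon>" "nat (- n)"] by simp
  qed
qed

lemma Z1_zero_of_generators:
  assumes f: "f \<in> Z1" and T0: "f T = Zm" and N0: "\<And>u. u \<in> \<O> \<Longrightarrow> f (N u) = Zm"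
    and g: "g \<in> carrier P"
  shows "f g = Zm"
proof -
  have pow: "f (par_elem (s ^ k) u) = Zm"
    if s: "s \<in> quad_units d" "f (par_elem s 0) = Zm" and u: "u \<in> \<O>" for s k u
    using u
  proof (induction k arbitrary: u)
    case (Suc k)
    have su: "s * u \<in> \<O>" using quad_unitsD(1)[OF s(1)] Suc.prems by (rule quad_ints_mult)
    have c: "par_elem s 0 \<in> carrier P" "par_elem (s ^ k) (s * u) \<in> carrier P"
      using s su quad_units_power by (auto intro: par_elem_closed)
    have inv: "inverse s * (s * u) = u" using quad_unitsD(3)[OF s(1)] by (simp flip: mult.assoc)
    \<comment> \<open>The parameter s u compensates for the factor 1/s in the product; for this
      reason u is left arbitrary in the induction.\<close>
    have "par_elem (s ^ Suc k) u = par_elem s 0 \<otimes>\<^bsub>P\<^esub> par_elem (s ^ k) (s * u)"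
      by (simp add: par_elem_mult inv)
    thus ?case using Z1D(2)[OF f c] Suc.IH[OF su] s(2) act_zero[OF c(1)] by simp
  qed (simp add: N0)
  have ie: "inverse \<epsilon> \<in> quad_units d" by (rule quad_unitsD(4)[OF eps(1)])
  have T'c: "par_elem (inverse \<epsilon>) 0 \<in> carrier P" using ie by (intro par_elem_closed) auto
  have "f (par_elem (inverse \<epsilon>) 0) = Zm"
  proof -
    \<comment> \<open>The value at the inverse of T comes from evaluating f at the product
      N(0).\<close>
    have "par_elem (inverse \<epsilon>) 0 \<otimes>\<^bsub>P\<^esub> T = N 0" using eps(2) by (simp add: par_elem_mult)
    hence "Zm = f (par_elem (inverse \<epsilon>) 0) + Zm"
      using Z1D(2)[OF f T'c T_closed] N0[of 0] T0 act_zero[OF T'c] by simp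
    thus ?thesis using Z1D(1)[OF f T'c] by simp
  qed
  hence pow': "f (par_elem (s ^ k) u) = Zm" if "s = \<epsilon> \<or> s = inverse \<epsilon>" "u \<in> \<O>" for s k u
    using that pow[OF eps(1) T0] pow[OF ie] by auto
  obtain t u where tu: "t \<in> quad_units d" "u \<in> \<O>" "g = par_elem t u" using g by (rule par_elemE)
  obtain k s where s: "s = \<epsilon> \<or> s = inverse \<epsilon>" and t: "t = s ^ k \<or> t = - (s ^ k)"
    using tu(1) by (rule quad_units_cases)
  from t show ?thesis
  proof
    assume "t = - (s ^ k)"
    \<comment> \<open>A negative unit is traded for -u, since (t, u) and (-t, -u) name the same
      element.\<close>
    hence "g = par_elem (s ^ k) (- u)" using par_elem_uminus[of "s ^ k" "- u"] tu by simp
    thus ?thesis using pow'[OF s quad_ints_minus[OF tu(2)]] by simp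
  qed (use pow'[OF s tu(2)] tu in simp)
qed

lemma zero_before_all_zero:
  assumes "X \<in> CM" "zero_before X 0 (Suc l2)"
  shows "X = Zm"
  using assms unfolding zero_before_def by (intro eq_matI) auto

lemma shift_zeroD:
  assumes f: "f \<in> Z1" and V: "V \<in> CM" and g: "g \<in> carrier P" and z: "shift f V g = Y" and Y: "Y \<in> CM"
  shows "f g = (act g V \<ominus>\<^bsub>VV\<^esub> V) \<oplus>\<^bsub>VV\<^esub> Y"
proof -
  have "f g - (act g V - V) = Y" using z g by (simp add: shift_def)
  hence "f g = (act g V - V) + Y"
    using Z1D(1)[OF f g] V act_closed[OF g V] Y by (intro eq_matI) auto
  thus ?thesis using V act_closed[OF g V] by (simp add: VV_minus VV_simps)
qed

lemma H1_dim_0: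
  assumes "l1 \<noteq> l2 \<or> sgn0 = -1"
  shows "has_dim class_ring (group_H1 P VV act) 0"
proof (rule linear_group_action.has_dim_group_H1_0[OF linear_action])
  fix f assume f: "f \<in> Z1"
  have "\<exists>V\<in>CM. gens_zero_before (shift f V) 0 (Suc l2)"
  proof (rule columns_reach[OF f])
    fix j assume "j < Suc l2" "sgn0 = 1"
    \<comment> \<open>With sign 1, l1 and l2 must differ, so m > 0 and j + m <= l2 + m < l2 + 2m =
      l1.\<close>
    thus "j + m < l1" using assms l1_eq by auto
  qed simp
  then obtain V where V: "V \<in> CM" "gens_zero_before (shift f V) 0 (Suc l2)" by blast
  note s = shift_Z1[OF f V(1)]
  have "shift f V g = Zm" if "g \<in> carrier P" for g
  proof (rule Z1_zero_of_generators[OF s _ _ that])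
    show "shift f V T = Zm" using V Z1D(1)[OF s T_closed] by (intro zero_before_all_zero) (auto simp: gens_zero_before_def)
    show "shift f V (N u) = Zm" if "u \<in> \<O>" for u
      using V Z1D(1)[OF s N_closed] that by (intro zero_before_all_zero) (auto simp: gens_zero_before_def)
  qed
  hence "f g = (act g V \<ominus>\<^bsub>VV\<^esub> V) \<oplus>\<^bsub>VV\<^esub> Zm" if "g \<in> carrier P" for g
    using that by (intro shift_zeroD f V) auto
  hence "f g = act g V \<ominus>\<^bsub>VV\<^esub> V" if "g \<in> carrier P" for g
    using that V act_closed[OF that V(1)] right_add_zero_mat[OF minus_carrier_mat[OF V(1)]]
    by (simp add: VV_minus VV_simps)
  thus "\<exists>v\<in>carrier VV. \<forall>g\<in>carrier P. f g = act g v \<ominus>\<^bsub>VV\<^esub> v" using V(1) unfolding VV_simps by blast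
qed

text \<open>
  Both matrices $g$ and $-g$ of a class give the same value.
\<close>

definition height :: "real mat set \<Rightarrow> real" where
  "height S = the_elem ((\<lambda>A. ln \<bar>A $$ (0, 0)\<bar> / ln \<epsilon>) ` S)"

lemma height_par_elem: "height (par_elem t u) = ln \<bar>t\<bar> / ln \<epsilon>"
  unfolding height_def par_elem_def by simp

text \<open>A homomorphism to the additive reals, placed on the line of the last entry. Division by
  log epsilon in \<open>height\<close> makes its value at T the matrix unit itself.\<close>

definition top_cocycle :: "real mat set \<Rightarrow> complex mat" where
  "top_cocycle = (\<lambda>g\<in>carrier P. of_real (height g) \<cdot>\<^sub>m elem_mat l1 l2 1)"

text \<open>Up to sign every unit is a power of epsilon or of its inverse, and N(-1) = 1, so its
  norm is a power of N(epsilon) or of its inverse.\<close>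

lemma quad_norm_power_eq_1:
  assumes "quad_norm d \<epsilon> ^ l = 1" and t: "t \<in> quad_units d"
  shows "(t * cj t) ^ l = 1"
proof -
  have n: "(s * cj s) ^ l = 1" if "s = \<epsilon> \<or> s = inverse \<epsilon>" for s
    using that assms(1) quad_unitsD(6)[OF eps(1)] unfolding quad_norm_def
    by (auto simp flip: inverse_mult_distrib simp: power_inverse mult.commute)
  obtain k s where s: "s = \<epsilon> \<or> s = inverse \<epsilon>" and ts: "t = s ^ k \<or> t = - (s ^ k)"
    using t by (rule quad_units_cases)
  have su: "s \<in> quad_units d" using s eps(1) quad_unitsD(4) by auto
  have "cj (s ^ k) = cj s ^ k" using quad_field_power quad_ints_field quad_unitsD(1)[OF su] by blast
  moreover have "cj (- (s ^ k)) = - cj (s ^ k)"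
    using quad_unitsD(1)[OF quad_units_power[OF su]] by (rule quad_conj_minus)
  ultimately have "t * cj t = (s * cj s) ^ k" using ts by (auto simp: power_mult_distrib)
  hence "(t * cj t) ^ l = ((s * cj s) ^ l) ^ k" by (simp add: power_mult[symmetric] mult.commute)
  thus ?thesis using n[OF s] by simp
qed

section \<open>The one-dimensional case\<close>

context
  assumes l12: "l1 = l2" and sgn1: "sgn0 = 1"
begin

text \<open>Only the last column of each triangular factor matters, and its single nonzero entry is
  diagonal; the two diagonal entries multiply to the inverse of N(t)^l2, which is 1.\<close>

lemma act_top:
  assumes "g \<in> carrier P"
  shows "act g (elem_mat l1 l2 1) = elem_mat l1 l2 1"
proof -
  obtain t u where tu: "t \<in> quad_units d" "u \<in> \<O>" "g = par_elem t u" using assms by (rule par_elemE)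
  have "act g (elem_mat l1 l2 1) $$ (i, j) = elem_mat l1 l2 1 $$ (i, j)" if ij: "i \<le> l1" "j \<le> l2" for i j
  proof -
    have "act g (elem_mat l1 l2 1) $$ (i, j) = (\<Sum>k<Suc l1. \<Sum>q<Suc l2.
      sym_lower l1 t u $$ (i, k) * elem_mat l1 l2 1 $$ (k, q) * sym_lower l2 (cj t) (cj u) $$ (j, q))"
      unfolding tu(3) by (rule act_index[OF tu(1,2) _ ij]) simp
    also have "\<dots> = (\<Sum>k<Suc l1. sym_lower l1 t u $$ (i, k) * elem_mat l1 l2 1 $$ (k, l2) * sym_lower l2 (cj t) (cj u) $$ (j, l2))"
      by (intro sum.cong[OF refl] sum_single) auto
    also have "\<dots> = sym_lower l1 t u $$ (i, l1) * elem_mat l1 l2 1 $$ (l1, l2) * sym_lower l2 (cj t) (cj u) $$ (j, l2)"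
      by (intro sum_single) auto
    also have "\<dots> = elem_mat l1 l2 1 $$ (i, j)"
    proof (cases "i = l1 \<and> j = l2")
      case True
      have "inverse t ^ l1 * inverse (cj t) ^ l2 = inverse ((t * cj t) ^ l2)"
        by (simp add: l12 power_mult_distrib power_inverse)
      also have "\<dots> = 1" using quad_norm_power_eq_1[OF sgn1 tu(1)] by simp
      finally have "complex_of_real (inverse t ^ l1 * inverse (cj t) ^ l2) = 1" by simp
      thus ?thesis using True by (simp add: sym_lower_index)
    qed (use ij in \<open>auto simp: sym_lower_index binomial_eq_0\<close>)
    finally show ?thesis .
  qed
  thus ?thesis using act_closed[OF assms, of "elem_mat l1 l2 1"] elem_mat(1)[of l1 l2 1]
    by (intro eq_matI) auto
qed

text \<open>A homomorphism into the invariants is a cocycle, and log|t| is additive on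
  products.\<close>

lemma top_cocycle_Z1: "top_cocycle \<in> Z1"
proof -
  have "of_real (height (g \<otimes>\<^bsub>P\<^esub> h)) \<cdot>\<^sub>m elem_mat l1 l2 1 =
      of_real (height g) \<cdot>\<^sub>m elem_mat l1 l2 1 + act g (of_real (height h) \<cdot>\<^sub>m elem_mat l1 l2 1)"
    if gh: "g \<in> carrier P" "h \<in> carrier P" for g h
  proof -
    obtain t u where g: "t \<in> quad_units d" "u \<in> \<O>" "g = par_elem t u" using gh(1) by (rule par_elemE)
    obtain s w where h: "s \<in> quad_units d" "w \<in> \<O>" "h = par_elem s w" using gh(2) by (rule par_elemE)
    have "height (g \<otimes>\<^bsub>P\<^esub> h) = height g + height h"
      using quad_unitsD(3)[OF g(1)] quad_unitsD(3)[OF h(1)]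
      by (simp add: g h par_elem_mult height_par_elem abs_mult ln_mult add_divide_distrib)
    thus ?thesis using gh by (simp add: act_smult act_top add_smult_distrib_right_mat[OF elem_mat(1)])
  qed
  thus ?thesis unfolding cocycles1_def VV_simps top_cocycle_def by (simp add: parabolic_closed)
qed

lemma top_cocycle_T: "top_cocycle T = elem_mat l1 l2 1"
proof -
  have "height T = 1" using eps(2) by (simp add: height_par_elem)
  thus ?thesis using T_closed by (intro eq_matI) (auto simp: top_cocycle_def elem_mat_def)
qed

lemma top_cocycle_N: "u \<in> \<O> \<Longrightarrow> top_cocycle (N u) = Zm"
  using N_closed by (intro eq_matI) (auto simp: top_cocycle_def height_par_elem elem_mat_def)

lemma weight_top: "weight l1 l2 = 1"
  using weight_special(1)[of l1 l2] l12 sgn1 by simp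

lemma H1_dim_1: "has_dim class_ring (group_H1 P VV act) 1"
proof (rule linear_group_action.has_dim_group_H1_1[OF linear_action top_cocycle_Z1])
  fix v assume "v \<in> carrier VV"
  hence v: "v \<in> CM" by (simp add: VV_simps)
  \<comment> \<open>At T the last entry of a coboundary carries the factor weight - 1 = 0.\<close>
  have "(act T v \<ominus>\<^bsub>VV\<^esub> v) $$ (l1, l2) = 0"
    using v act_closed[OF T_closed v] act_T_index[OF v, of l1 l2] weight_top by (simp add: VV_minus)
  moreover have "top_cocycle T $$ (l1, l2) = 1" by (simp add: top_cocycle_T)
  ultimately have "top_cocycle T \<noteq> act T v \<ominus>\<^bsub>VV\<^esub> v" by auto
  thus "\<exists>g\<in>carrier P. top_cocycle g \<noteq> act g v \<ominus>\<^bsub>VV\<^esub> v" using T_closed by blast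
next
  fix f assume f: "f \<in> Z1"
  have r0: "\<exists>V\<in>CM. gens_zero_before (shift f V) 0 l2"
    using l12 by (intro columns_reach[OF f]) auto
  have "\<exists>V\<in>CM. gens_zero_before (shift f V) l1 l2"
    by (rule reach_weight_zero[OF f le_refl r0]) (simp_all add: l12)
  then obtain V where V: "V \<in> CM" "gens_zero_before (shift f V) l1 l2" by blast
  define h where "h = shift f V"
  have h: "h \<in> Z1" "gens_zero_before h l1 l2" using shift_Z1[OF f V(1)] V(2) by (auto simp: h_def)
  \<comment> \<open>The only entry not yet normalised; c is the coordinate of the class of
    f.\<close>
  define c where "c = h T $$ (l1, l2)"
  \<comment> \<open>The weight 1 differs from mu and 1/mu, so the vanishing holds here without a row
    below.\<close>
  have hN: "h (N u) $$ (l1, l2) = 0" if "u \<in> \<O>" for u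
    using weight_top mu that by (intro entry_zero_of_eigen[OF h]) auto
  have zc: "(\<lambda>g\<in>carrier P. c \<cdot>\<^sub>m top_cocycle g) \<in> Z1" by (rule Z1_smult[OF top_cocycle_Z1])
  define k where "k = (\<lambda>g\<in>carrier P. h g - c \<cdot>\<^sub>m top_cocycle g)"
  have k: "k \<in> Z1" using Z1_diff[OF h(1) zc] by (simp add: k_def cong: restrict_cong)
  have all: "p < l1 \<or> q < l2 \<Longrightarrow> p \<le> l1 \<Longrightarrow> q \<le> l2 \<Longrightarrow> X $$ (p, q) = 0" if "zero_before X l1 l2" for X p q
    using that by (intro zero_beforeD[OF that]) auto
  have kg: "k g = Zm" if "g \<in> carrier P" for g
  proof (rule Z1_zero_of_generators[OF k _ _ that])
    show "k T = Zm"
    proof (rule eq_matI)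
      fix p q assume "p < dim_row Zm" "q < dim_col Zm"
      hence pq: "p \<le> l1" "q \<le> l2" by auto
      have "k T $$ (p, q) = h T $$ (p, q) - c * elem_mat l1 l2 1 $$ (p, q)"
        using T_closed Z1D(1)[OF h(1) T_closed] pq elem_mat(1)[of l1 l2 1] by (simp add: k_def top_cocycle_T del: elem_mat)
      also have "\<dots> = 0"
        using all[of "h T" p q] h(2) pq by (cases "p = l1 \<and> q = l2") (auto simp: gens_zero_before_def c_def)
      finally show "k T $$ (p, q) = Zm $$ (p, q)" using pq by simp
    qed (use Z1D(1)[OF k T_closed] in auto)
    show "k (N u) = Zm" if u: "u \<in> \<O>" for u
    proof (rule eq_matI)
      fix p q assume "p < dim_row Zm" "q < dim_col Zm"
      hence pq: "p \<le> l1" "q \<le> l2" by auto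
      have "k (N u) $$ (p, q) = h (N u) $$ (p, q)"
        using N_closed[OF u] Z1D(1)[OF h(1) N_closed[OF u]] pq by (simp add: k_def top_cocycle_N u)
      also have "\<dots> = 0"
        using all[of "h (N u)" p q] h(2) pq u hN[OF u] by (cases "p = l1 \<and> q = l2") (auto simp: gens_zero_before_def)
      finally show "k (N u) $$ (p, q) = Zm $$ (p, q)" using pq by simp
    qed (use Z1D(1)[OF k N_closed[OF u]] in auto)
  qed
  have "f g = (act g V \<ominus>\<^bsub>VV\<^esub> V) \<oplus>\<^bsub>VV\<^esub> c \<odot>\<^bsub>VV\<^esub> top_cocycle g" if g: "g \<in> carrier P" for g
  proof -
    have tc: "top_cocycle g \<in> CM" by (rule Z1D(1)[OF top_cocycle_Z1 g])
    have "h g - c \<cdot>\<^sub>m top_cocycle g = Zm" using kg[OF g] g by (simp add: k_def)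
    hence "h g = c \<cdot>\<^sub>m top_cocycle g"
      by (rule mat_eq_if_minus_zero[OF Z1D(1)[OF h(1) g] smult_carrier_mat[OF tc]])
    hence "shift f V g = c \<cdot>\<^sub>m top_cocycle g" by (simp add: h_def)
    thus ?thesis using tc V f g unfolding VV_simps(4) by (intro shift_zeroD) auto
  qed
  thus "\<exists>c\<in>carrier class_ring. \<exists>v\<in>carrier VV. \<forall>g\<in>carrier P.
      f g = (act g v \<ominus>\<^bsub>VV\<^esub> v) \<oplus>\<^bsub>VV\<^esub> c \<odot>\<^bsub>VV\<^esub> top_cocycle g"
    using V(1) unfolding VV_simps(1) by (intro bexI[of _ c] bexI[of _ V]) auto
qed

end

end

theorem theorem3p7:
  fixes d l1 l2 :: nat and \<epsilon> :: real
  assumes "squarefree d" and "d > 1"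
    and "is_fundamental_unit d \<epsilon>"
    and "l1 \<ge> l2" and "[l1 = l2] (mod 2)"
  defines "H \<equiv> group_H1 (parabolic d) (tensor_space (l1 + 1) (l2 + 1)) (V_act d l1 l2)"
  shows "(l1 \<noteq> l2 \<or> quad_norm d \<epsilon> ^ l1 = -1 \<longrightarrow> has_dim class_ring H 0) \<and>
         (l1 = l2 \<and> quad_norm d \<epsilon> ^ l1 = 1 \<longrightarrow> has_dim class_ring H 1)"
proof -
  interpret parabolic_coeffs d \<epsilon> l1 l2
    using assms(1-5) by unfold_locales auto
  have H: "H = group_H1 (parabolic d) (tensor_space (Suc l1) (Suc l2)) (V_act d l1 l2)"
    unfolding H_def by simp
  \<comment> \<open>If l1 = l2, the exponents l1 and l2 of the norm agree; if they differ, the first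
    alternative of \<open>H1_dim_0\<close> applies.\<close>
  show ?thesis unfolding H using H1_dim_0 H1_dim_1 by auto
qed

end
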